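(* Let $\alpha\in(0,1)$, let $S=S_\alpha$, and let $(\Omega_S,J)$ be the almost complex manifold described in the context, with $\lambda(z_1,z_2)=-2|z_2|^\alpha$ (so that $J$ is $\alpha$-Hölder continuous). Then the Kobayashi-Royden pseudonorm $(\vec x,\vec v)\mapsto\|(\vec x,\vec v)\|_K$ of $(\Omega_S,J)$ is not upper semicontinuous on $T\Omega_S$.
   Context: For $R>0$, $D_R=\{z\in\mathbb{C}:|z|<R\}$. For $\alpha\in(0,1)$ define $$S_\alpha=\begin{cases}\left(\alpha(1-\alpha)\right)^{1/(2-2\alpha)}&\text{if }0<\alpha\le\frac23,\\[4pt]\left(\dfrac{4\alpha(1-\alpha)^2}{2-\alpha}\right)^{1/(2-2\alpha)}&\text{if }\frac23\le\alpha<1.\end{cases}$$ For $S>0$, let $\Omega_S=D_2\times D_S\subseteq\mathbb{C}^2$, regarded as an open subset of $\mathbb{R}^4$ with coordinates $\vec x=(x_1,y_1,x_2,y_2)=(z_1,z_2)$, $z_k=x_k+iy_k$, and with trivial tangent bundle $T\Omega_S=\Omega_S\times\mathbb{R}^4\subseteq T\mathbb{R}^4$. Given a function $\lambda:\Omega_S\to\mathbb{R}$, the almost complex structure $J$ on $\Omega_S$ is given at $\vec x$ by the matrix $$J(\vec x)=\begin{pmatrix}0&-1&0&0\\1&0&0&0\\0&\lambda(\vec x)&0&-1\\\lambda(\vec x)&0&1&0\end{pmatrix}.$$ For $r>0$, a map $Z:D_r\to\Omega_S$ is a $J$-holomorphic disk if $Z\in\mathcal{C}^1(D_r)$ and $dZ\circ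 J_{std}=J\circ dZ$, where $J_{std}$ is the standard complex structure on $D_r\subseteq\mathbb{C}$ (with coordinate $z=x+iy$, $J_{std}\frac{\partial}{\partial x}=\frac{\partial}{\partial y}$, $J_{std}\frac{\partial}{\partial y}=-\frac{\partial}{\partial x}$). The Kobayashi-Royden pseudonorm on $\Omega_S$ is the function $T\Omega_S\to\mathbb{R}$, $(\vec x,\vec v)\mapsto\|(\vec x,\vec v)\|_K$, where for $\vec v\in T_{\vec x}\Omega_S$, $\|(\vec x,\vec v)\|_K$ is the greatest lower bound of the set $$\left\{\tfrac1r:\ r>0,\ \exists\text{ a }J\text{-holomorphic }Z:D_r\to\Omega_S\text{ with }Z(0)=\vec x,\ dZ(0)\left(\tfrac{\partial}{\partial x}\right)=\vec v\right\}.$$ (For $\lambda\in\mathcal{C}^{0,\alpha}(\Omega_S)$ with $0<\alpha<1$ it is known that this set is nonempty, so the pseudonorm is well defined.) *)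

theory Defs
  imports "HOL-Analysis.Analysis"
begin

text \<open>The coordinates \<open>(x\<^sub>1, y\<^sub>1, x\<^sub>2, y\<^sub>2)\<close> of \<open>\<complex>\<^sup>2 = \<real>\<^sup>4\<close> are the components
  \<open>1, 2, 3, 4\<close> of \<^typ>\<open>real^4\<close>.\<close>

definition z1 :: "real^4 \<Rightarrow> complex" where
  "z1 x = Complex (x $ 1) (x $ 2)"

definition z2 :: "real^4 \<Rightarrow> complex" where
  "z2 x = Complex (x $ 3) (x $ 4)"

definition disk :: "real \<Rightarrow> complex set" where
  "disk R = {z. cmod z < R}"

definition S_crit :: "real \<Rightarrow> real" where
  "S_crit \<alpha> =
     (if \<alpha> \<le> 2 / 3 then (\<alpha> * (1 - \<alpha>)) powr (1 / (2 - 2 * \<alpha>))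
      else (4 * \<alpha> * (1 - \<alpha>)\<^sup>2 / (2 - \<alpha>)) powr (1 / (2 - 2 * \<alpha>)))"

definition Omega :: "real \<Rightarrow> (real^4) set" where
  "Omega S = {x. z1 x \<in> disk 2 \<and> z2 x \<in> disk S}"

definition J_mat :: "(real^4 \<Rightarrow> real) \<Rightarrow> real^4 \<Rightarrow> real^4^4" where
  "J_mat lam x = vector
     [vector [0, -1, 0, 0],
      vector [1, 0, 0, 0],
      vector [0, lam x, 0, -1],
      vector [lam x, 0, 1, 0]]"

definition J_std :: "complex \<Rightarrow> complex" where
  "J_std w = \<i> * w"

definition C1_on :: "('a::real_normed_vector \<Rightarrow> 'b::real_normed_vector) \<Rightarrow> 'a set \<Rightarrow> bool" where
  "C1_on f U \<longleftrightarrow> (\<exists>f' :: 'a \<Rightarrow> 'a \<Rightarrow>\<^sub>L 'b.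
     (\<forall>u\<in>U. (f has_derivative blinfun_apply (f' u)) (at u)) \<and> continuous_on U f')"

text \<open>A disk is a total function of which only the values on \<open>disk r\<close> matter.\<close>

definition J_holomorphic_disk ::
    "(real^4) set \<Rightarrow> (real^4 \<Rightarrow> real^4^4) \<Rightarrow> real \<Rightarrow> (complex \<Rightarrow> real^4) \<Rightarrow> bool" where
  "J_holomorphic_disk \<Omega> J r Z \<longleftrightarrow>
     Z ` disk r \<subseteq> \<Omega> \<and> C1_on Z (disk r) \<and>
     (\<forall>z\<in>disk r. frechet_derivative Z (at z) \<circ> J_std =
        (\<lambda>v. J (Z z) *v v) \<circ> frechet_derivative Z (at z))"

text \<open>In \<^typ>\<open>complex\<close>, the tangent vector \<open>\<partial>/\<partial>x\<close> is \<open>1\<close>. The infimum is that of a set of reals,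
  hence meaningful only because the set is nonempty for the structures considered.\<close>

definition kobayashi_royden ::
    "(real^4) set \<Rightarrow> (real^4 \<Rightarrow> real^4^4) \<Rightarrow> (real^4) \<times> (real^4) \<Rightarrow> real" where
  "kobayashi_royden \<Omega> J = (\<lambda>(x, v). Inf {1 / r | r. r > 0 \<and>
     (\<exists>Z. J_holomorphic_disk \<Omega> J r Z \<and> Z 0 = x \<and> frechet_derivative Z (at 0) 1 = v)})"

definition tangent_bundle :: "(real^4) set \<Rightarrow> ((real^4) \<times> (real^4)) set" where
  "tangent_bundle \<Omega> = \<Omega> \<times> UNIV"

definition upper_semicontinuous_on :: "'a::topological_space set \<Rightarrow> ('a \<Rightarrow> real) \<Rightarrow> bool" where
  "upper_semicontinuous_on A f \<longleftrightarrow>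
     (\<forall>a\<in>A. \<forall>c. f a < c \<longrightarrow> (\<forall>\<^sub>F y in at a within A. f y < c))"

definition lambda_alpha :: "real \<Rightarrow> real^4 \<Rightarrow> real" where
  "lambda_alpha \<alpha> x = - 2 * cmod (z2 x) powr \<alpha>"

lemma vector_4 [simp]:
  "(vector [a, b, c, d] :: 'a::zero^4) $ 1 = a"
  "(vector [a, b, c, d] :: 'a::zero^4) $ 2 = b"
  "(vector [a, b, c, d] :: 'a::zero^4) $ 3 = c"
  "(vector [a, b, c, d] :: 'a::zero^4) $ 4 = d"
  by (simp_all add: vector_def)

lemma J_mat_squared: "J_mat lam x ** J_mat lam x = - mat 1"
  by (simp add: vec_eq_iff forall_4 J_mat_def matrix_matrix_mult_def sum_4 mat_def)

lemma powr_add_le: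
  fixes a b \<alpha> :: real
  assumes "0 \<le> a" "0 \<le> b" "0 < \<alpha>" "\<alpha> < 1"
  shows "(a + b) powr \<alpha> \<le> a powr \<alpha> + b powr \<alpha>"
proof (cases "a + b = 0")
  case True
  then show ?thesis using assms by simp
next
  case False
  then have s: "a + b > 0" using assms by linarith
  have *: "t \<le> t powr \<alpha>" if "0 \<le> t" "t \<le> 1" for t :: real
    using powr_mono'[of \<alpha> 1 t] that assms by (cases "t = 0") auto
  have "1 = a / (a + b) + b / (a + b)"
    using s by (simp add: add_divide_distrib[symmetric])
  also have "\<dots> \<le> (a / (a + b)) powr \<alpha> + (b / (a + b)) powr \<alpha>"
    using assms s by (intro add_mono *) auto
  also have "\<dots> = (a powr \<alpha> + b powr \<alpha>) / (a + b) powr \<alpha>"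
    using assms s by (simp add: powr_divide add_divide_distrib)
  finally show ?thesis
    using s by (simp add: field_simps)
qed

lemma lambda_alpha_Hoelder:
  assumes "0 < \<alpha>" "\<alpha> < 1"
  shows "\<bar>lambda_alpha \<alpha> x - lambda_alpha \<alpha> y\<bar> \<le> 2 * cmod (z2 x - z2 y) powr \<alpha>"
proof -
  have *: "cmod u powr \<alpha> \<le> cmod w powr \<alpha> + cmod (u - w) powr \<alpha>" for u w
  proof -
    have "cmod u \<le> cmod w + cmod (u - w)"
      by (metis add_diff_cancel_left' diff_add_cancel norm_triangle_ineq add.commute)
    then have "cmod u powr \<alpha> \<le> (cmod w + cmod (u - w)) powr \<alpha>"
      using assms by (intro powr_mono2) auto
    also have "\<dots> \<le> cmod w powr \<alpha> + cmod (u - w) powr \<alpha>"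
      using assms by (intro powr_add_le) auto
    finally show ?thesis .
  qed
  show ?thesis
    using *[of "z2 x" "z2 y"] *[of "z2 y" "z2 x"]
    by (simp add: lambda_alpha_def norm_minus_commute abs_le_iff)
qed

end

(* A disk Z = (h, f) is J-holomorphic iff h is holomorphic and the d-bar derivative of f is
   |f|^\<alpha> cnj h'. At (0, d/dx_1) the disk z \<mapsto> (z, 0) of radius 2 gives pseudonorm at most 1/2.
   At the points (0, b) with b > 0 and tangent vectors converging to (1, 0), any admissible disk has
   radius at most 1.998: otherwise the Schwarz lemma forces h to be nearly the identity, and if
   f(0) \<noteq> 0, comparing |f|^2 with (C |h|^2)^(1/(1-\<alpha>)) by a maximum principle shows that |f| must
   exceed S_\<alpha> somewhere. The maximum principle is applied in terms of means over small circles,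
   because f is only known to be C^1. These points carry some disk at all because an \<alpha>-power
   ODE in x = Re z gives explicit ones. *)

theory Submission
  imports Defs "HOL-Complex_Analysis.Complex_Analysis"
begin

section \<open>Means over small circles\<close>

text \<open>The obstacle is that |f|^\<alpha> is not Lipschitz at f = 0: the zero solution and
  growing solutions coexist there, so disks through (0, b) need not resemble the disk through (0,
  0), however small b is. The exponent and constant of the barrier W = (C |h|^2)^(1/(1-\<alpha>))
  are forced by matching a quarter of its Laplacian with the lower bound (1 + 3\<alpha>/4)
  |f|^(2\<alpha>) |h'|^2 for |f|^2. The barrier must dominate \<open>S_crit \<alpha>\<close> squared
  on a circle. As \<alpha> tends to 1 this requires |h| >= 4 / sqrt 7, about 1.512; without the gain
  3\<alpha>/4 it would require |h| to approach 2, the bound on |h| in the domain. Hence the careful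
  Laplacian estimate, and hence the need for h to be close to the identity on a circle as large as
  |z| = 17/10. Closeness to the identity has a second use: h' has no zero inside that circle, which
  keeps the comparison at an interior maximum strict. The value 1.998 only has to be below 2 and
  close enough for these two estimates. The term |f|^\<alpha> is differentiated only at a point
  where |f|^2 > W >= 0, so its singularity at f = 0 does no harm.\<close>

lemma has_integral_cis:
  "((\<lambda>t. cis t) has_integral 0) {0..2*pi}"
  "((\<lambda>t. cis (-t)) has_integral 0) {0..2*pi}"
  "((\<lambda>t. cis (-2*t)) has_integral 0) {0..2*pi}"
  "((\<lambda>t. cis (2*t)) has_integral 0) {0..2*pi}"
proof -
  have *: "((\<lambda>t. cis (k*t)) has_integral (cis (k*(2*pi)) / (k*\<i>) - cis (k*0) / (k*\<i>))) {0..2*pi}" if "k \<noteq> 0" for k :: real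
    by (rule fundamental_theorem_of_calculus)
       (use that in \<open>auto simp: cis_conv_exp intro!: derivative_eq_intros has_vector_derivative_real_field simp: field_simps\<close>)
  have c4: "cis (4*pi) = 1" using cis_mult[of "2*pi" "2*pi"] by simp
  show "((\<lambda>t. cis t) has_integral 0) {0..2*pi}" using *[of 1] by simp
  show "((\<lambda>t. cis (-t)) has_integral 0) {0..2*pi}" using *[of "-1"] by (simp flip: cis_cnj)
  show "((\<lambda>t. cis (-2*t)) has_integral 0) {0..2*pi}" using *[of "-2"] c4 by (simp flip: cis_cnj)
  show "((\<lambda>t. cis (2*t)) has_integral 0) {0..2*pi}" using *[of "2"] c4 by simp
qed

text \<open>The zeroth Fourier mode of \<open>F\<close> on small circles is governed by the d-bar derivative \<open>b\<close> alone:
  its radial derivative is \<open>2 \<integral> b exp(-i t) dt\<close>. Hence a function that is only once continuously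
  differentiable has a second-order expansion of its circle means as soon as \<open>b\<close> is
  differentiable at the centre, and no elliptic regularity is needed.\<close>

lemma circle_mean_expansion:
  fixes F a b :: "complex \<Rightarrow> complex" and b1 b2 :: complex
  assumes \<delta>: "0 < \<delta>"
    and dF: "\<And>z. z \<in> ball z0 \<delta> \<Longrightarrow> (F has_derivative (\<lambda>v. a z * v + b z * cnj v)) (at z)"
    and ca: "continuous_on (ball z0 \<delta>) a" and cb: "continuous_on (ball z0 \<delta>) b"
    and db: "(b has_derivative (\<lambda>v. b1 * v + b2 * cnj v)) (at z0)"
  shows "((\<lambda>\<rho>. (integral {0..2*pi} (\<lambda>t. F (z0 + of_real \<rho> * cis t)) - 2 * pi * F z0) / of_real (\<rho>\<^sup>2))
            \<longlongrightarrow> of_real (2 * pi) * b1) (at_right 0)"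
proof -
  define P where "P = (\<lambda>\<rho> t. z0 + complex_of_real \<rho> * cis t)"
  define I where "I = (\<lambda>\<rho>. integral {0..2*pi} (\<lambda>t. F (P \<rho> t)))"
  have P_ball: "P \<rho> t \<in> ball z0 \<delta>" if "\<rho> \<in> {0..<\<delta>}" for \<rho> t
    using that by (simp add: P_def dist_norm norm_mult)
  have P_cont: "continuous_on A (\<lambda>(x, t). P x t)" for A
    unfolding P_def split_def by (intro continuous_intros)
  have P_cont': "continuous_on A (P \<rho>)" for A \<rho>
    unfolding P_def by (intro continuous_intros)
  have cF: "continuous_on (ball z0 \<delta>) F"
    by (meson dF continuous_at_imp_continuous_on has_derivative_continuous)
  have cP: "continuous_on A (\<lambda>t. g (P \<rho> t))" if "continuous_on (ball z0 \<delta>) g" "\<rho> \<in> {0..<\<delta>}"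
    for g :: "complex \<Rightarrow> complex" and A \<rho>
    using continuous_on_compose2[OF that(1) P_cont'[of A \<rho>]] P_ball[OF that(2)] by blast
  have int_b: "(\<lambda>t. b (P \<rho> t) * cis (-t)) integrable_on {0..2*pi}" if "\<rho> \<in> {0..<\<delta>}" for \<rho>
    by (intro integrable_continuous_interval continuous_intros cP cb that)
  have int_a: "(\<lambda>t. a (P \<rho> t) * cis t) integrable_on {0..2*pi}" if "\<rho> \<in> {0..<\<delta>}" for \<rho>
    by (intro integrable_continuous_interval continuous_intros cP ca that)
  \<comment> \<open>The angular derivative of \<open>F\<close> along a circle is \<rho> i (a e^(it)
    - b e^(-it)) and integrates to zero over a full turn. This trades the term in \<open>a\<close>,
    which is merely continuous, for the term in \<open>b\<close>, which is differentiable at the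
    centre.\<close>
  have angular: "integral {0..2*pi} (\<lambda>t. a (P \<rho> t) * cis t) = integral {0..2*pi} (\<lambda>t. b (P \<rho> t) * cis (-t))"
    if \<rho>: "\<rho> \<in> {0..<\<delta>}" for \<rho>
  proof (cases "\<rho> = 0")
    case True
    then have "P \<rho> t = z0" for t by (simp add: P_def)
    moreover have "integral {0..2*pi} (\<lambda>t. a z0 * cis t) = a z0 * 0"
      "integral {0..2*pi} (\<lambda>t. b z0 * cis (-t)) = b z0 * 0"
      by (intro integral_unique has_integral_mult_right has_integral_cis)+
    ultimately show ?thesis by auto
  next
    case False
    have "((\<lambda>t. of_real \<rho> * \<i> * (a (P \<rho> t) * cis t - b (P \<rho> t) * cis (-t))) has_integral F (P \<rho> (2*pi)) - F (P \<rho> 0)) {0..2*pi}"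
    proof (rule fundamental_theorem_of_calculus)
      fix t :: real
      have "(P \<rho> has_vector_derivative of_real \<rho> * (\<i> * cis t)) (at t within {0..2*pi})"
        unfolding P_def cis_conv_exp
        by (auto intro!: derivative_eq_intros has_vector_derivative_real_field)
      moreover have "(F has_derivative (\<lambda>v. a (P \<rho> t) * v + b (P \<rho> t) * cnj v)) (at (P \<rho> t) within P \<rho> ` {0..2*pi})"
        by (rule has_derivative_at_withinI[OF dF[OF P_ball[OF \<rho>]]])
      ultimately have "((F \<circ> P \<rho>) has_vector_derivative (a (P \<rho> t) * (of_real \<rho> * (\<i> * cis t)) + b (P \<rho> t) * cnj (of_real \<rho> * (\<i> * cis t)))) (at t within {0..2*pi})"
        by (rule vector_derivative_diff_chain_within)
      then show "((\<lambda>t. F (P \<rho> t)) has_vector_derivative of_real \<rho> * \<i> * (a (P \<rho> t) * cis t - b (P \<rho> t) * cis (-t))) (at t within {0..2*pi})"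
        by (simp add: o_def algebra_simps flip: cis_cnj)
    qed simp
    moreover have "P \<rho> (2*pi) = P \<rho> 0" by (simp add: P_def)
    ultimately have "((\<lambda>t. of_real \<rho> * \<i> * (a (P \<rho> t) * cis t - b (P \<rho> t) * cis (-t))) has_integral 0) {0..2*pi}"
      by simp
    then have "integral {0..2*pi} (\<lambda>t. of_real \<rho> * \<i> * (a (P \<rho> t) * cis t - b (P \<rho> t) * cis (-t))) = 0"
      by (rule integral_unique)
    then have "integral {0..2*pi} (\<lambda>t. a (P \<rho> t) * cis t - b (P \<rho> t) * cis (-t)) = 0"
      using False by simp
    then show ?thesis
      by (simp add: integral_diff int_a[OF \<rho>] int_b[OF \<rho>])
  qed
  have dI: "(I has_vector_derivative 2 * integral {0..2*pi} (\<lambda>t. b (P \<rho> t) * cis (-t))) (at \<rho> within {0..<\<delta>})"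
    if \<rho>: "\<rho> \<in> {0..<\<delta>}" for \<rho>
  proof -
    let ?U = "{0..<\<delta>}"
    have "((\<lambda>x. integral (cbox 0 (2*pi)) (\<lambda>t. F (P x t))) has_vector_derivative
        integral (cbox 0 (2*pi)) (\<lambda>t. a (P \<rho> t) * cis t + b (P \<rho> t) * cis (-t))) (at \<rho> within ?U)"
    proof (rule leibniz_rule_vector_derivative)
      fix x t :: real
      assume x: "x \<in> ?U"
      have "((\<lambda>x. P x t) has_vector_derivative cis t) (at x within ?U)"
        unfolding P_def by (auto intro!: derivative_eq_intros)
      moreover have "(F has_derivative (\<lambda>v. a (P x t) * v + b (P x t) * cnj v)) (at (P x t) within (\<lambda>x. P x t) ` ?U)"
        by (rule has_derivative_at_withinI[OF dF[OF P_ball[OF x]]])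
      ultimately have "((F \<circ> (\<lambda>x. P x t)) has_vector_derivative (a (P x t) * cis t + b (P x t) * cnj (cis t))) (at x within ?U)"
        by (rule vector_derivative_diff_chain_within)
      then show "((\<lambda>x. F (P x t)) has_vector_derivative a (P x t) * cis t + b (P x t) * cis (-t)) (at x within ?U)"
        by (simp add: o_def flip: cis_cnj)
    next
      fix x :: real assume "x \<in> ?U"
      then show "(\<lambda>t. F (P x t)) integrable_on cbox 0 (2*pi)"
        using cP[OF cF] by (intro integrable_continuous) auto
    next
      have "continuous_on (?U \<times> cbox 0 (2*pi)) (\<lambda>p. g (case p of (x,t) \<Rightarrow> P x t))"
        if "continuous_on (ball z0 \<delta>) g" for g :: "complex \<Rightarrow> complex"
        by (rule continuous_on_compose2[OF that P_cont]) (use P_ball in auto)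
      from this[OF ca] this[OF cb]
      show "continuous_on (?U \<times> cbox 0 (2*pi)) (\<lambda>(x,t). a (P x t) * cis t + b (P x t) * cis (-t))"
        unfolding split_def by (intro continuous_intros) auto
    qed (use \<rho> in auto)
    then show ?thesis
      using int_a[OF \<rho>] int_b[OF \<rho>] angular[OF \<rho>] by (simp add: I_def integral_add)
  qed
  have I0: "I 0 = 2 * pi * F z0" by (simp add: I_def P_def scaleR_conv_of_real)
  show ?thesis
  proof (rule tendstoI)
    fix e :: real assume e: "e > 0"
    define \<epsilon> where "\<epsilon> = e / (8 * pi)"
    have \<epsilon>: "\<epsilon> > 0" using e by (simp add: \<epsilon>_def)
    from db[unfolded has_derivative_at_alt] \<epsilon> obtain d where d: "d > 0" and
      dbd: "\<And>y. norm (y - z0) < d \<Longrightarrow> norm (b y - b z0 - (b1 * (y - z0) + b2 * cnj (y - z0))) \<le> \<epsilon> * norm (y - z0)"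
      by blast
    have derbound: "norm (2 * integral {0..2*pi} (\<lambda>t. b (P \<rho> t) * cis (-t)) - of_real (4 * pi) * b1 * \<rho>) \<le> 4 * pi * \<epsilon> * \<rho>"
      if \<rho>: "\<rho> \<in> {0..<min d \<delta>}" for \<rho>
    proof -
      have \<rho>': "\<rho> \<in> {0..<\<delta>}" using \<rho> by auto
      \<comment> \<open>Multiplied by e^(-it), the first-order Taylor polynomial of \<open>b\<close>
        has modes -1, 0 and -2; only the mode 0, with coefficient \<open>b1\<close>, survives
        integration.\<close>
      have "((\<lambda>t. b z0 * cis (-t) + b1 * of_real \<rho> + b2 * of_real \<rho> * cis (-2*t)) has_integral
              (b z0 * 0 + (2*pi - 0) *\<^sub>R (b1 * of_real \<rho>) + b2 * of_real \<rho> * 0)) {0..2*pi}"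
        by (intro has_integral_add has_integral_mult_right has_integral_cis)
           (use has_integral_const_real[of "b1 * of_real \<rho>" 0 "2*pi"] in auto)
      then have m: "((\<lambda>t. b z0 * cis (-t) + b1 * of_real \<rho> + b2 * of_real \<rho> * cis (-2*t)) has_integral
              of_real (2 * pi) * b1 * \<rho>) {0..2*pi}"
        by (simp add: scaleR_conv_of_real mult_ac)
      have "((\<lambda>t. b (P \<rho> t) * cis (-t) - (b z0 * cis (-t) + b1 * of_real \<rho> + b2 * of_real \<rho> * cis (-2*t))) has_integral
          (integral {0..2*pi} (\<lambda>t. b (P \<rho> t) * cis (-t)) - of_real (2 * pi) * b1 * \<rho>)) {0..2*pi}"
        by (intro has_integral_diff m integrable_integral int_b \<rho>')
      then have "((\<lambda>t. b (P \<rho> t) * cis (-t) - (b z0 * cis (-t) + b1 * of_real \<rho> + b2 * of_real \<rho> * cis (-2*t))) has_integral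
          (integral {0..2*pi} (\<lambda>t. b (P \<rho> t) * cis (-t)) - of_real (2 * pi) * b1 * \<rho>)) (cbox 0 (2*pi))"
        by simp
      then have "norm (integral {0..2*pi} (\<lambda>t. b (P \<rho> t) * cis (-t)) - of_real (2 * pi) * b1 * \<rho>)
          \<le> (\<epsilon> * \<rho>) * measure lborel (cbox 0 (2*pi))"
      proof (rule has_integral_bound[rotated])
        fix t
        have e1: "b (P \<rho> t) * cis (-t) - (b z0 * cis (-t) + b1 * of_real \<rho> + b2 * of_real \<rho> * cis (-2*t))
           = (b (P \<rho> t) - b z0 - (b1 * (P \<rho> t - z0) + b2 * cnj (P \<rho> t - z0))) * cis (-t)"
        proof -
          have ring: "x * d - (y * d + b1 * r * (c * d) + b2 * r * (d * d)) = (x - y - (b1 * (r * c) + b2 * (r * d))) * d"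
            for x y r c d :: complex by (simp add: algebra_simps)
          have "P \<rho> t - z0 = of_real \<rho> * cis t" "cnj (P \<rho> t - z0) = of_real \<rho> * cis (-t)"
            by (simp_all add: P_def cis_cnj)
          moreover have "cis t * cis (-t) = 1" "cis (-t) * cis (-t) = cis (-2*t)" by (simp_all add: cis_mult)
          ultimately show ?thesis using ring[of "b (P \<rho> t)" "cis (-t)" "b z0" "of_real \<rho>" "cis t"] by (simp only: mult_1_right)
        qed
        have n: "norm (P \<rho> t - z0) = \<rho>" using \<rho> by (simp add: P_def norm_mult)
        show "norm (b (P \<rho> t) * cis (-t) - (b z0 * cis (-t) + b1 * of_real \<rho> + b2 * of_real \<rho> * cis (-2*t))) \<le> \<epsilon> * \<rho>"
          unfolding e1 norm_mult using dbd[of "P \<rho> t"] n \<rho> by simp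
      qed (use \<epsilon> \<rho> in auto)
      then have "norm (2 * (integral {0..2*pi} (\<lambda>t. b (P \<rho> t) * cis (-t)) - of_real (2 * pi) * b1 * \<rho>)) \<le> 4 * pi * \<epsilon> * \<rho>"
        unfolding norm_mult by (simp add: mult_ac)
      then show ?thesis by (simp add: right_diff_distrib mult_ac)
    qed
    have main: "norm (I \<rho> - 2 * pi * F z0 - of_real (2 * pi) * b1 * of_real (\<rho>\<^sup>2)) \<le> 4 * pi * \<epsilon> * \<rho>\<^sup>2"
      if \<rho>: "\<rho> \<in> {0..<min d \<delta>}" for \<rho>
    proof -
      \<comment> \<open>Subtracting the expected quadratic term leaves a function with small
        derivative, so the mean value inequality bounds it by a small multiple of \<rho>^2.\<close>
      define J where "J = (\<lambda>\<rho>. I \<rho> - of_real (2 * pi) * b1 * of_real (\<rho>\<^sup>2))"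
      have dJ: "(J has_vector_derivative 2 * integral {0..2*pi} (\<lambda>t. b (P x t) * cis (-t)) - of_real (4 * pi) * b1 * x) (at x within {0..\<rho>})"
        if x: "x \<in> {0..\<rho>}" for x
      proof -
        have "(I has_vector_derivative 2 * integral {0..2*pi} (\<lambda>t. b (P x t) * cis (-t))) (at x within {0..\<rho>})"
          by (rule has_vector_derivative_within_subset[OF dI]) (use x \<rho> in auto)
        then show ?thesis unfolding J_def
          by (auto intro!: derivative_eq_intros has_vector_derivative_real_field)
      qed
      have "norm (J \<rho> - J 0) \<le> (4 * pi * \<epsilon> * \<rho>) * norm (\<rho> - 0)"
      proof (rule differentiable_bound[where S="{0..\<rho>}"])
        fix x assume x: "x \<in> {0..\<rho>}"
        show "(J has_derivative (\<lambda>h. h *\<^sub>R (2 * integral {0..2*pi} (\<lambda>t. b (P x t) * cis (-t)) - of_real (4 * pi) * b1 * x))) (at x within {0..\<rho>})"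
          using dJ[OF x] by (simp add: has_vector_derivative_def)
        have "norm (2 * integral {0..2*pi} (\<lambda>t. b (P x t) * cis (-t)) - of_real (4 * pi) * b1 * x) \<le> 4 * pi * \<epsilon> * x"
          by (rule derbound) (use x \<rho> in auto)
        also have "\<dots> \<le> 4 * pi * \<epsilon> * \<rho>" using x \<epsilon> by (intro mult_left_mono) auto
        finally show "onorm (\<lambda>h. h *\<^sub>R (2 * integral {0..2*pi} (\<lambda>t. b (P x t) * cis (-t)) - of_real (4 * pi) * b1 * x)) \<le> 4 * pi * \<epsilon> * \<rho>"
          by (intro onorm_le) (simp add: mult.commute mult_left_mono)
      qed (use \<rho> in auto)
      then show ?thesis using \<rho> by (simp add: J_def I0 power2_eq_square algebra_simps)
    qed
    have "\<forall>\<^sub>F \<rho> in at_right 0. \<rho> \<in> {0<..<min d \<delta>}"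
      using d \<delta> by (intro eventually_at_right_real) auto
    then show "\<forall>\<^sub>F \<rho> in at_right 0. dist ((integral {0..2*pi} (\<lambda>t. F (z0 + of_real \<rho> * cis t)) - 2 * pi * F z0) / of_real (\<rho>\<^sup>2)) (of_real (2 * pi) * b1) < e"
    proof eventually_elim
      case (elim \<rho>)
      then have \<rho>: "\<rho> > 0" "\<rho> \<in> {0..<min d \<delta>}" by auto
      have "(I \<rho> - 2 * pi * F z0) / of_real (\<rho>\<^sup>2) - of_real (2 * pi) * b1 = (I \<rho> - 2 * pi * F z0 - of_real (2 * pi) * b1 * of_real (\<rho>\<^sup>2)) / of_real (\<rho>\<^sup>2)"
        using \<rho> by (simp add: field_simps)
      then have "norm ((I \<rho> - 2 * pi * F z0) / of_real (\<rho>\<^sup>2) - of_real (2 * pi) * b1) \<le> 4 * pi * \<epsilon>"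
        using main[OF \<rho>(2)] \<rho> by (simp add: norm_divide divide_le_eq norm_power del: of_real_power)
      also have "\<dots> < e" using e by (simp add: \<epsilon>_def)
      finally show ?case by (simp add: dist_norm I_def P_def)
    qed
  qed
qed

text \<open>The limit is 2 pi times a quarter of the formal Laplacian of |F|^2, with
  \<open>b1\<close> in the place of the mixed second derivative. In |F|^2 = |F0|^2 + 2 Re (cnj F0 (F
  - F0)) + |F - F0|^2, where F0 is the value at the centre, the linear term is covered by
  \<open>circle_mean_expansion\<close>, and the quadratic one needs only the first derivative at the
  centre.\<close>

lemma circle_mean_norm2_expansion:
  fixes F a b :: "complex \<Rightarrow> complex" and b1 b2 :: complex
  assumes \<delta>: "0 < \<delta>"
    and dF: "\<And>z. z \<in> ball z0 \<delta> \<Longrightarrow> (F has_derivative (\<lambda>v. a z * v + b z * cnj v)) (at z)"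
    and ca: "continuous_on (ball z0 \<delta>) a" and cb: "continuous_on (ball z0 \<delta>) b"
    and db: "(b has_derivative (\<lambda>v. b1 * v + b2 * cnj v)) (at z0)"
  shows "((\<lambda>\<rho>. (integral {0..2*pi} (\<lambda>t. (norm (F (z0 + of_real \<rho> * cis t)))\<^sup>2) - 2 * pi * (norm (F z0))\<^sup>2) / \<rho>\<^sup>2)
            \<longlongrightarrow> 2 * pi * (2 * Re (cnj (F z0) * b1) + (norm (a z0))\<^sup>2 + (norm (b z0))\<^sup>2)) (at_right 0)"
proof -
  define P where "P = (\<lambda>\<rho> t. z0 + complex_of_real \<rho> * cis t)"
  define L where "L = (\<lambda>t. a z0 * cis t + b z0 * cis (-t))"
  define K where "K = norm (a z0) + norm (b z0)"
  have K: "norm (L t) \<le> K" "K \<ge> 0" for t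
    unfolding L_def K_def by (auto intro!: norm_triangle_le simp: norm_mult)
  have P_ball: "P \<rho> t \<in> ball z0 \<delta>" if "\<rho> \<in> {0..<\<delta>}" for \<rho> t
    using that by (simp add: P_def dist_norm norm_mult)
  have P_cont: "continuous_on A (P \<rho>)" for A \<rho>
    unfolding P_def by (intro continuous_intros)
  have cF: "continuous_on (ball z0 \<delta>) F"
    by (meson dF continuous_at_imp_continuous_on has_derivative_continuous)
  have cFP: "continuous_on A (\<lambda>t. F (P \<rho> t))" if "\<rho> \<in> {0..<\<delta>}" for A \<rho>
    using continuous_on_compose2[OF cF P_cont[of A \<rho>]] P_ball[OF that] by blast
  have intL: "((\<lambda>t. (norm (L t))\<^sup>2) has_integral 2 * pi * ((norm (a z0))\<^sup>2 + (norm (b z0))\<^sup>2)) {0..2*pi}"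
  proof -
    have eq: "(norm (L t))\<^sup>2 = ((norm (a z0))\<^sup>2 + (norm (b z0))\<^sup>2) + 2 * Re (a z0 * cnj (b z0) * cis (2*t))" for t
    proof -
      have "complex_of_real ((norm (L t))\<^sup>2) = (a z0 * cis t + b z0 * cis (-t)) * (cnj (a z0) * cis (-t) + cnj (b z0) * cis t)"
        by (simp only: complex_norm_square L_def) (simp add: cis_cnj)
      also have "\<dots> = (a z0 * cnj (a z0) + b z0 * cnj (b z0)) * (cis t * cis (-t)) + (a z0 * cnj (b z0) * (cis t * cis t) + b z0 * cnj (a z0) * (cis (-t) * cis (-t)))"
        by (simp add: algebra_simps)
      also have "\<dots> = (a z0 * cnj (a z0) + b z0 * cnj (b z0)) + (a z0 * cnj (b z0) * cis (2*t) + cnj (a z0 * cnj (b z0) * cis (2*t)))"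
        by (simp add: cis_mult cis_cnj)
      also have "\<dots> = of_real ((norm (a z0))\<^sup>2 + (norm (b z0))\<^sup>2 + 2 * Re (a z0 * cnj (b z0) * cis (2*t)))"
        by (simp only: complex_add_cnj of_real_add complex_norm_square)
      finally show ?thesis using of_real_eq_iff by blast
    qed
    have "((\<lambda>t. Re (a z0 * cnj (b z0) * cis (2*t))) has_integral Re (a z0 * cnj (b z0) * 0)) {0..2*pi}"
      using has_integral_linear[OF has_integral_mult_right[OF has_integral_cis(4), of "a z0 * cnj (b z0)"] bounded_linear_Re]
      by (simp only: o_def)
    then have "((\<lambda>t. ((norm (a z0))\<^sup>2 + (norm (b z0))\<^sup>2) + 2 * Re (a z0 * cnj (b z0) * cis (2*t))) has_integral
        (2 * pi - 0) *\<^sub>R ((norm (a z0))\<^sup>2 + (norm (b z0))\<^sup>2) + 2 * Re (a z0 * cnj (b z0) * 0)) {0..2*pi}"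
      by (intro has_integral_add has_integral_mult_right)
         (use has_integral_const_real[of "(norm (a z0))\<^sup>2 + (norm (b z0))\<^sup>2" 0 "2*pi"] in auto)
    then show ?thesis by (simp add: eq)
  qed
  have quad: "((\<lambda>\<rho>. integral {0..2*pi} (\<lambda>t. (norm (F (P \<rho> t) - F z0))\<^sup>2) / \<rho>\<^sup>2) \<longlongrightarrow> 2 * pi * ((norm (a z0))\<^sup>2 + (norm (b z0))\<^sup>2)) (at_right 0)"
  proof (rule tendstoI)
    fix e :: real assume e: "e > 0"
    \<comment> \<open>The bound by 1 gives |D| + |L| <= 2K + 1 below; the other bound makes the
      integrated error at most e/2.\<close>
    define \<epsilon> where "\<epsilon> = min 1 (e / (4 * pi * (2 * K + 1)))"
    have \<epsilon>: "\<epsilon> > 0" "\<epsilon> \<le> 1" using e K(2) by (auto simp: \<epsilon>_def)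
    have "\<epsilon> * (2 * K + 1) \<le> e / (4 * pi * (2 * K + 1)) * (2 * K + 1)"
      using K(2) by (intro mult_right_mono) (auto simp: \<epsilon>_def)
    also have "\<dots> = e / (4 * pi)" using K(2) by simp
    finally have \<epsilon>e: "2 * pi * (\<epsilon> * (2 * K + 1)) < e" using e pi_gt_zero by (simp add: field_simps)
    from dF[of z0, unfolded has_derivative_at_alt] \<epsilon> \<delta> obtain d where d: "d > 0" and
      dFd: "\<And>y. norm (y - z0) < d \<Longrightarrow> norm (F y - F z0 - (a z0 * (y - z0) + b z0 * cnj (y - z0))) \<le> \<epsilon> * norm (y - z0)"
      by (metis centre_in_ball)
    have "\<forall>\<^sub>F \<rho> in at_right 0. \<rho> \<in> {0<..<min d \<delta>}"
      using d \<delta> by (intro eventually_at_right_real) auto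
    then show "\<forall>\<^sub>F \<rho> in at_right 0. dist (integral {0..2*pi} (\<lambda>t. (norm (F (P \<rho> t) - F z0))\<^sup>2) / \<rho>\<^sup>2) (2 * pi * ((norm (a z0))\<^sup>2 + (norm (b z0))\<^sup>2)) < e"
    proof eventually_elim
      case (elim \<rho>)
      then have \<rho>: "\<rho> > 0" "\<rho> \<in> {0..<\<delta>}" "\<rho> < d" by auto
      define D where "D = (\<lambda>t. (F (P \<rho> t) - F z0) / of_real \<rho>)"
      have DL: "norm (D t - L t) \<le> \<epsilon>" for t
      proof -
        have "norm (P \<rho> t - z0) = \<rho>" using \<rho> by (simp add: P_def norm_mult)
        with dFd[of "P \<rho> t"] \<rho> have "norm (F (P \<rho> t) - F z0 - (a z0 * (P \<rho> t - z0) + b z0 * cnj (P \<rho> t - z0))) \<le> \<epsilon> * \<rho>"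
          by simp
        moreover have "F (P \<rho> t) - F z0 - (a z0 * (P \<rho> t - z0) + b z0 * cnj (P \<rho> t - z0)) = of_real \<rho> * (D t - L t)"
          using \<rho> by (simp add: D_def L_def P_def cis_cnj field_simps)
        ultimately show ?thesis using \<rho> by (simp add: norm_mult)
      qed
      have DL2: "norm ((norm (D t))\<^sup>2 - (norm (L t))\<^sup>2) \<le> \<epsilon> * (2 * K + 1)" for t
      proof -
        have "(norm (D t))\<^sup>2 - (norm (L t))\<^sup>2 = (norm (D t) - norm (L t)) * (norm (D t) + norm (L t))"
          by (simp add: algebra_simps power2_eq_square)
        then have "norm ((norm (D t))\<^sup>2 - (norm (L t))\<^sup>2) = \<bar>norm (D t) - norm (L t)\<bar> * (norm (D t) + norm (L t))"
          by (simp add: abs_mult)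
        also have "\<dots> \<le> \<epsilon> * (2 * K + 1)"
        proof (rule mult_mono)
          show "\<bar>norm (D t) - norm (L t)\<bar> \<le> \<epsilon>"
            using norm_triangle_ineq3[of "D t" "L t"] DL[of t] by linarith
          then show "norm (D t) + norm (L t) \<le> 2 * K + 1"
            using K(1)[of t] \<epsilon> by linarith
        qed (use \<epsilon> in auto)
        finally show ?thesis .
      qed
      have "(\<lambda>t. (norm (D t))\<^sup>2) integrable_on {0..2*pi}"
        unfolding D_def using \<rho>(1) by (intro integrable_continuous_interval continuous_intros cFP \<rho>(2)) auto
      then have "((\<lambda>t. (norm (D t))\<^sup>2 - (norm (L t))\<^sup>2) has_integral
          (integral {0..2*pi} (\<lambda>t. (norm (D t))\<^sup>2) - 2 * pi * ((norm (a z0))\<^sup>2 + (norm (b z0))\<^sup>2))) (cbox 0 (2*pi))"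
        using has_integral_diff[OF integrable_integral intL] by simp
      then have "norm (integral {0..2*pi} (\<lambda>t. (norm (D t))\<^sup>2) - 2 * pi * ((norm (a z0))\<^sup>2 + (norm (b z0))\<^sup>2))
          \<le> (\<epsilon> * (2 * K + 1)) * measure lborel (cbox 0 (2*pi))"
        by (rule has_integral_bound[rotated]) (use \<epsilon> K(2) DL2 in auto)
      also have "\<dots> < e" using \<epsilon>e by (simp add: mult_ac)
      finally have "dist (integral {0..2*pi} (\<lambda>t. (norm (D t))\<^sup>2)) (2 * pi * ((norm (a z0))\<^sup>2 + (norm (b z0))\<^sup>2)) < e"
        by (simp add: dist_norm)
      moreover have "(norm (D t))\<^sup>2 = (norm (F (P \<rho> t) - F z0))\<^sup>2 / \<rho>\<^sup>2" for t
        by (simp add: D_def norm_divide power_divide)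
      ultimately show ?case by simp
    qed
  qed
  have lin: "((\<lambda>\<rho>. 2 * Re (cnj (F z0) * ((integral {0..2*pi} (\<lambda>t. F (P \<rho> t)) - 2 * pi * F z0) / of_real (\<rho>\<^sup>2))))
            \<longlongrightarrow> 2 * Re (cnj (F z0) * (of_real (2 * pi) * b1))) (at_right 0)"
    using circle_mean_expansion[OF assms] unfolding P_def by (intro tendsto_intros)
  have "\<forall>\<^sub>F \<rho> in at_right 0. \<rho> \<in> {0<..<\<delta>}"
    using \<delta> by (intro eventually_at_right_real) auto
  then have "\<forall>\<^sub>F \<rho> in at_right 0.
     2 * Re (cnj (F z0) * ((integral {0..2*pi} (\<lambda>t. F (P \<rho> t)) - 2 * pi * F z0) / of_real (\<rho>\<^sup>2)))
      + integral {0..2*pi} (\<lambda>t. (norm (F (P \<rho> t) - F z0))\<^sup>2) / \<rho>\<^sup>2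
     = (integral {0..2*pi} (\<lambda>t. (norm (F (P \<rho> t)))\<^sup>2) - 2 * pi * (norm (F z0))\<^sup>2) / \<rho>\<^sup>2"
  proof eventually_elim
    case (elim \<rho>)
    then have \<rho>: "\<rho> \<in> {0..<\<delta>}" "\<rho> > 0" by auto
    define A where "A = integral {0..2*pi} (\<lambda>t. F (P \<rho> t))"
    define B where "B = integral {0..2*pi} (\<lambda>t. (norm (F (P \<rho> t) - F z0))\<^sup>2)"
    have A: "((\<lambda>t. F (P \<rho> t)) has_integral A) {0..2*pi}" unfolding A_def
      by (intro integrable_integral integrable_continuous_interval cFP \<rho>)
    have B: "((\<lambda>t. (norm (F (P \<rho> t) - F z0))\<^sup>2) has_integral B) {0..2*pi}" unfolding B_def
      by (intro integrable_integral integrable_continuous_interval continuous_intros cFP \<rho>)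
    have c: "((\<lambda>t. F z0) has_integral (2*pi) *\<^sub>R F z0) {0..2*pi}"
      using has_integral_const_real[of "F z0" 0 "2*pi"] by simp
    have c': "((\<lambda>t. (norm (F z0))\<^sup>2) has_integral (2*pi) *\<^sub>R (norm (F z0))\<^sup>2) {0..2*pi}"
      using has_integral_const_real[of "(norm (F z0))\<^sup>2" 0 "2*pi"] by simp
    have expand: "(norm y)\<^sup>2 = (norm x)\<^sup>2 + (2 * Re (cnj x * (y - x)) + (norm (y - x))\<^sup>2)" for x y :: complex
      by (simp only: cmod_power2) (simp add: algebra_simps power2_eq_square)
    have "((\<lambda>t. Re (cnj (F z0) * (F (P \<rho> t) - F z0))) has_integral Re (cnj (F z0) * (A - (2*pi) *\<^sub>R F z0))) {0..2*pi}"
      using has_integral_linear[OF has_integral_mult_right[OF has_integral_diff[OF A c], of "cnj (F z0)"] bounded_linear_Re]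
      by (simp only: o_def)
    then have "((\<lambda>t. (norm (F z0))\<^sup>2 + (2 * Re (cnj (F z0) * (F (P \<rho> t) - F z0)) + (norm (F (P \<rho> t) - F z0))\<^sup>2)) has_integral
       (2*pi) *\<^sub>R (norm (F z0))\<^sup>2 + (2 * Re (cnj (F z0) * (A - (2*pi) *\<^sub>R F z0)) + B)) {0..2*pi}"
      by (intro has_integral_add c' B has_integral_mult_right)
    then have "((\<lambda>t. (norm (F (P \<rho> t)))\<^sup>2) has_integral
       (2*pi) *\<^sub>R (norm (F z0))\<^sup>2 + (2 * Re (cnj (F z0) * (A - (2*pi) *\<^sub>R F z0)) + B)) {0..2*pi}"
      by (simp only: expand[of "F (P \<rho> t)" "F z0" for t])
    then have i: "integral {0..2*pi} (\<lambda>t. (norm (F (P \<rho> t)))\<^sup>2) = 2 * pi * (norm (F z0))\<^sup>2 + (2 * Re (cnj (F z0) * (A - 2*pi * F z0)) + B)"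
      by (simp add: integral_unique scaleR_conv_of_real)
    have "Re (cnj (F z0) * ((A - 2 * pi * F z0) / of_real (\<rho>\<^sup>2))) = Re (cnj (F z0) * (A - 2*pi * F z0)) / \<rho>\<^sup>2"
      by (metis Re_divide_of_real times_divide_eq_right)
    then show ?case unfolding i A_def[symmetric] B_def[symmetric] by (simp add: add_divide_distrib)
  qed
  from Lim_transform_eventually[OF tendsto_add[OF lin quad] this]
  have "((\<lambda>\<rho>. (integral {0..2*pi} (\<lambda>t. (norm (F (P \<rho> t)))\<^sup>2) - 2 * pi * (norm (F z0))\<^sup>2) / \<rho>\<^sup>2)
      \<longlongrightarrow> 2 * Re (cnj (F z0) * (of_real (2 * pi) * b1)) + 2 * pi * ((norm (a z0))\<^sup>2 + (norm (b z0))\<^sup>2)) (at_right 0)" .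
  moreover have "2 * Re (cnj (F z0) * (of_real (2 * pi) * b1)) + 2 * pi * ((norm (a z0))\<^sup>2 + (norm (b z0))\<^sup>2)
    = 2 * pi * (2 * Re (cnj (F z0) * b1) + (norm (a z0))\<^sup>2 + (norm (b z0))\<^sup>2)"
    by (simp add: algebra_simps)
  ultimately show ?thesis by (simp add: P_def)
qed

text \<open>This replaces the second-derivative test: around a maximum the circle means of |F|^2 -
  |H|^2 do not exceed the central value, so the second-order coefficients are ordered. For
  holomorphic \<open>H\<close> the d-bar derivative vanishes and the coefficient reduces to
  |H'|^2.\<close>

lemma local_max_norm2_diff_holomorphic:
  fixes F a b H :: "complex \<Rightarrow> complex" and b1 b2 :: complex
  assumes \<delta>: "0 < \<delta>"
    and dF: "\<And>z. z \<in> ball z0 \<delta> \<Longrightarrow> (F has_derivative (\<lambda>v. a z * v + b z * cnj v)) (at z)"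
    and ca: "continuous_on (ball z0 \<delta>) a" and cb: "continuous_on (ball z0 \<delta>) b"
    and db: "(b has_derivative (\<lambda>v. b1 * v + b2 * cnj v)) (at z0)"
    and H: "H holomorphic_on ball z0 \<delta>"
    and max: "\<And>z. z \<in> ball z0 \<delta> \<Longrightarrow> (norm (F z))\<^sup>2 - (norm (H z))\<^sup>2 \<le> (norm (F z0))\<^sup>2 - (norm (H z0))\<^sup>2"
  shows "2 * Re (cnj (F z0) * b1) + (norm (a z0))\<^sup>2 + (norm (b z0))\<^sup>2 \<le> (norm (deriv H z0))\<^sup>2"
proof -
  define M where "M = (\<lambda>G \<rho>. (integral {0..2*pi} (\<lambda>t. (norm (G (z0 + of_real \<rho> * cis t) :: complex))\<^sup>2) - 2 * pi * (norm (G z0))\<^sup>2) / \<rho>\<^sup>2)"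
  have "(M F \<longlongrightarrow> 2 * pi * (2 * Re (cnj (F z0) * b1) + (norm (a z0))\<^sup>2 + (norm (b z0))\<^sup>2)) (at_right 0)"
    unfolding M_def by (rule circle_mean_norm2_expansion[OF \<delta> dF ca cb db])
  moreover have "(M H \<longlongrightarrow> 2 * pi * (2 * Re (cnj (H z0) * 0) + (norm (deriv H z0))\<^sup>2 + (norm (0::complex))\<^sup>2)) (at_right 0)"
    unfolding M_def
  proof (rule circle_mean_norm2_expansion[OF \<delta>, where b = "\<lambda>_. 0" and ?b2.0 = 0])
    fix z assume "z \<in> ball z0 \<delta>"
    then have "(H has_field_derivative deriv H z) (at z)"
      by (intro holomorphic_derivI[OF H]) auto
    then show "(H has_derivative (\<lambda>v. deriv H z * v + 0 * cnj v)) (at z)"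
      by (simp add: has_field_derivative_def)
  qed (auto intro!: holomorphic_on_imp_continuous_on holomorphic_deriv H)
  moreover have "\<forall>\<^sub>F \<rho> in at_right 0. \<rho> \<in> {0<..<\<delta>}"
    using \<delta> by (intro eventually_at_right_real) auto
  then have "\<forall>\<^sub>F \<rho> in at_right 0. M F \<rho> \<le> M H \<rho>"
  proof eventually_elim
    case (elim \<rho>)
    have cF: "continuous_on (ball z0 \<delta>) F"
      by (meson dF continuous_at_imp_continuous_on has_derivative_continuous)
    note cH = holomorphic_on_imp_continuous_on[OF H]
    have ball: "z0 + of_real \<rho> * cis t \<in> ball z0 \<delta>" for t
      using elim by (simp add: dist_norm norm_mult)
    have int: "(\<lambda>t. (norm (G (z0 + of_real \<rho> * cis t)))\<^sup>2) integrable_on {0..2*pi}"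
      if "continuous_on (ball z0 \<delta>) G" for G :: "complex \<Rightarrow> complex"
      by (intro integrable_continuous_interval continuous_intros continuous_on_compose2[OF that]) (use ball in auto)
    have "integral {0..2*pi} (\<lambda>t. (norm (F (z0 + of_real \<rho> * cis t)))\<^sup>2)
        \<le> integral {0..2*pi} (\<lambda>t. (norm (H (z0 + of_real \<rho> * cis t)))\<^sup>2 + ((norm (F z0))\<^sup>2 - (norm (H z0))\<^sup>2))"
      by (intro integral_le int cF integrable_add cH integrable_const_ivl) (use max[OF ball] in \<open>simp add: algebra_simps\<close>)
    also have "\<dots> = integral {0..2*pi} (\<lambda>t. (norm (H (z0 + of_real \<rho> * cis t)))\<^sup>2) + 2 * pi * ((norm (F z0))\<^sup>2 - (norm (H z0))\<^sup>2)"
      by (subst integral_add) (auto intro!: int cH)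
    finally show ?case unfolding M_def
      by (intro divide_right_mono) (auto simp: algebra_simps)
  qed
  ultimately have "2 * pi * (2 * Re (cnj (F z0) * b1) + (norm (a z0))\<^sup>2 + (norm (b z0))\<^sup>2)
     \<le> 2 * pi * (2 * Re (cnj (H z0) * 0) + (norm (deriv H z0))\<^sup>2 + (norm (0::complex))\<^sup>2)"
    by (intro tendsto_le[of "at_right (0::real)"]) auto
  then show ?thesis by simp
qed

section \<open>Holomorphic maps close to the identity\<close>

text \<open>A stability version of the equality case of the Schwarz lemma: the largest possible
  |h'(0)| is 2/r, barely above the prescribed value 1.\<close>

lemma near_identity:
  assumes holh: "h holomorphic_on ball 0 r" and r: "r > 999/500"
    and bd: "\<And>z. z \<in> ball 0 r \<Longrightarrow> norm (h z) < 2"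
    and h0: "h 0 = 0" and h1: "deriv h 0 = 1" and z: "norm z \<le> 9/5"
  shows "norm (h z - z) \<le> norm z / 40"
proof -
  obtain q where holq: "q holomorphic_on ball 0 r" and hq: "\<And>z. norm z < r \<Longrightarrow> h z = z * q z" and q0: "deriv h 0 = q 0"
    using Schwarz3[OF holh h0] by blast
  have rpos: "r > 0" using r by linarith
  have scale: "(\<lambda>w. of_real r * w) ` ball 0 1 \<subseteq> ball (0::complex) r"
    using rpos by (auto simp: norm_mult)
  \<comment> \<open>Since \<open>2 / r < 1 / s\<close>, the map \<open>s q\<close> sends the disk to the unit disk and the centre to \<open>s\<close>, a
    point close to the boundary; the Schwarz lemma after a Moebius map then keeps it close to \<open>s\<close>.\<close>
  define s :: real where "s = 999/1000"
  define g where "g = (\<lambda>w. h (of_real r * w) / 2)"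
  have holg: "g holomorphic_on ball 0 1"
    unfolding g_def by (intro holomorphic_intros holomorphic_on_compose_gen[OF _ holh scale, unfolded o_def]) auto
  have g1: "norm (g w) < 1" if "norm w < 1" for w
    using bd[of "of_real r * w"] that rpos by (simp add: g_def norm_mult norm_divide)
  have qbd': "s * norm (q (of_real r * w)) < 1" if w: "norm w < 1" "w \<noteq> 0" for w
  proof -
    have "norm (g w) \<le> norm w"
      by (rule Schwarz_Lemma(1)[OF holg]) (use h0 g1 w in \<open>auto simp: g_def\<close>)
    moreover have "norm (g w) = norm w * (r * norm (q (of_real r * w)) / 2)"
      using hq[of "of_real r * w"] w rpos by (simp add: g_def norm_mult norm_divide)
    ultimately have "r * norm (q (of_real r * w)) / 2 \<le> 1"
      using w by (simp add: mult_le_cancel_left1)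
    show ?thesis
    proof (cases "q (of_real r * w) = 0")
      case False
      then have "s * norm (q (of_real r * w)) < r / 2 * norm (q (of_real r * w))"
        using r by (intro mult_strict_right_mono) (auto simp: s_def)
      then show ?thesis using \<open>r * norm (q (of_real r * w)) / 2 \<le> 1\<close> by simp
    qed simp
  qed
  define \<phi> where "\<phi> = (\<lambda>w. of_real s * q (of_real r * w))"
  have \<phi>0: "\<phi> 0 = of_real s" using q0 h1 by (simp add: \<phi>_def)
  have \<phi>1: "norm (\<phi> w) < 1" if "norm w < 1" for w
    using qbd'[OF that] \<phi>0 by (cases "w = 0") (auto simp: \<phi>_def norm_mult s_def)
  have hol\<phi>: "\<phi> holomorphic_on ball 0 1"
    unfolding \<phi>_def by (intro holomorphic_intros holomorphic_on_compose_gen[OF _ holq scale, unfolded o_def])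
  define \<psi> where "\<psi> = (\<lambda>w. (\<phi> w - of_real s) / (1 - of_real s * \<phi> w))"
  have den: "1 - of_real s * \<phi> w \<noteq> 0" if "norm w < 1" for w
  proof
    assume "1 - of_real s * \<phi> w = 0"
    then have "norm (of_real s * \<phi> w) = 1" by simp
    moreover have "norm (of_real s * \<phi> w) \<le> 1 * norm (\<phi> w)"
      unfolding norm_mult by (intro mult_right_mono) (auto simp: s_def)
    ultimately show False using \<phi>1[OF that] by simp
  qed
  have hol\<psi>: "\<psi> holomorphic_on ball 0 1"
    unfolding \<psi>_def by (intro holomorphic_intros hol\<phi>) (use den in auto)
  have \<psi>1: "norm (\<psi> w) < 1" if w: "norm w < 1" for w
  proof -
    have "norm (Moebius_function 0 (of_real s) (\<phi> w)) < 1"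
      by (rule Moebius_function_norm_lt_1) (use \<phi>1[OF w] in \<open>auto simp: s_def\<close>)
    then show ?thesis by (simp add: Moebius_function_simple \<psi>_def)
  qed
  have znr: "norm z < r" using z r by linarith
  define w where "w = z / of_real r"
  \<comment> \<open>The constant is (9/5) / (999/500) = 100/111.\<close>
  have w: "norm w < 1" "norm w \<le> 100/111" "z = of_real r * w"
    using z r znr rpos by (auto simp: w_def norm_divide divide_le_eq)
  have "norm (\<psi> w) \<le> norm w"
    by (rule Schwarz_Lemma(1)[OF hol\<psi>]) (use \<phi>0 \<psi>1 w in \<open>auto simp: \<psi>_def\<close>)
  then have "norm (\<phi> w - of_real s) \<le> norm w * norm (1 - of_real s * \<phi> w)"
    using den[OF w(1)] by (simp add: \<psi>_def norm_divide divide_le_eq)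
  also have "\<dots> \<le> 100/111 * ((1 - s\<^sup>2) + s * norm (\<phi> w - of_real s))"
  proof (rule mult_mono)
    have "1 - of_real s * \<phi> w = of_real (1 - s\<^sup>2) - of_real s * (\<phi> w - of_real s)"
      by (simp add: algebra_simps power2_eq_square)
    also have "norm \<dots> \<le> norm (of_real (1 - s\<^sup>2) :: complex) + norm (of_real s * (\<phi> w - of_real s))"
      by (rule norm_triangle_ineq4)
    also have "\<dots> = (1 - s\<^sup>2) + s * norm (\<phi> w - of_real s)"
      unfolding norm_mult norm_of_real by (simp add: s_def power2_eq_square)
    finally show "norm (1 - of_real s * \<phi> w) \<le> (1 - s\<^sup>2) + s * norm (\<phi> w - of_real s)" .
  qed (use w in auto)
  \<comment> \<open>Since 100/111 * s = 9/10, the inequality can be solved for the norm: it is at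
    most 10 * 100/111 * (1 - s^2), about 0.018, below s/40.\<close>
  finally have "norm (\<phi> w - of_real s) \<le> s / 40"
    by (simp add: s_def power2_eq_square)
  moreover have "\<phi> w - of_real s = of_real s * (q z - 1)" by (simp add: \<phi>_def w algebra_simps)
  moreover have "norm (of_real s * (q z - 1)) = s * norm (q z - 1)"
    unfolding norm_mult norm_of_real by (simp add: s_def)
  ultimately have "s * norm (q z - 1) \<le> s / 40" by metis
  then have "norm (q z - 1) \<le> 1/40" by (simp add: s_def)
  then have "norm z * norm (q z - 1) \<le> norm z * (1/40)" by (intro mult_left_mono) auto
  moreover have "h z - z = z * (q z - 1)" using hq[OF znr] by (simp add: algebra_simps)
  ultimately show ?thesis by (simp add: norm_mult)
qed

text \<open>Cauchy's estimate on circles of radius 1/10 stays in |z| <= 9/5, where h differs from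
  the identity by at most 9/200. Hence h' is within 9/20 of 1.\<close>

lemma near_identity_deriv:
  assumes holh: "h holomorphic_on ball 0 r" and r: "r > 999/500"
    and bd: "\<And>z. z \<in> ball 0 r \<Longrightarrow> norm (h z) < 2"
    and h0: "h 0 = 0" and h1: "deriv h 0 = 1" and z: "norm z \<le> 17/10"
  shows "deriv h z \<noteq> 0"
proof -
  have sub: "cball z (1/10) \<subseteq> ball 0 r"
  proof
    fix y assume "y \<in> cball z (1/10)"
    then have "norm (y - z) \<le> 1/10" by (simp add: dist_norm norm_minus_commute)
    then show "y \<in> ball 0 r" using norm_triangle_sub[of y z] z r by simp
  qed
  have hol: "(\<lambda>w. h w - w) holomorphic_on ball 0 r" by (intro holomorphic_intros holh)
  have "norm ((deriv ^^ 1) (\<lambda>w. h w - w) z) \<le> fact 1 * (9/200) / (1/10)^1"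
  proof (rule Cauchy_inequality)
    show "(\<lambda>w. h w - w) holomorphic_on ball z (1/10)"
      by (rule holomorphic_on_subset[OF hol]) (use sub ball_subset_cball in blast)
    show "continuous_on (cball z (1/10)) (\<lambda>w. h w - w)"
      by (rule continuous_on_subset[OF holomorphic_on_imp_continuous_on[OF hol] sub])
    fix x assume "norm (z - x) = 1/10"
    then have "norm x \<le> 9/5" using norm_triangle_sub[of x z] z by (simp add: norm_minus_commute)
    then show "norm (h x - x) \<le> 9/200"
      using near_identity[OF holh r bd h0 h1, of x] by simp
  qed simp
  moreover have "deriv (\<lambda>w. h w - w) z = deriv h z - 1"
  proof -
    have "(h has_field_derivative deriv h z) (at z)"
      by (rule holomorphic_derivI[OF holh]) (use z r in auto)
    then show ?thesis by (intro DERIV_imp_deriv derivative_eq_intros) auto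
  qed
  ultimately show ?thesis by auto
qed

section \<open>The comparison principle\<close>

text \<open>Away from zeros, |f|^\<alpha> = (f cnj f)^(\<alpha>/2), and the Wirtinger chain rule
  yields \<open>c\<close> as its z-derivative. The second coefficient is \<open>cnj c\<close>
  because the function is real-valued.\<close>

lemma cmod_powr_has_derivative:
  fixes f :: "complex \<Rightarrow> complex" and a b :: complex and \<alpha> :: real
  assumes df: "(f has_derivative (\<lambda>v. a * v + b * cnj v)) (at z)" and nz: "f z \<noteq> 0"
  defines "c \<equiv> of_real (\<alpha> / 2 * (cmod (f z) powr \<alpha> / (cmod (f z))\<^sup>2)) * (cnj (f z) * a + f z * cnj b)"
  shows "((\<lambda>z. complex_of_real (cmod (f z) powr \<alpha>)) has_derivative (\<lambda>v. c * v + cnj c * cnj v)) (at z)"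
proof -
  have dn: "((\<lambda>z. cmod (f z)) has_derivative (\<lambda>v. inner (a * v + b * cnj v) (sgn (f z)))) (at z)"
    using has_derivative_compose[OF df has_derivative_norm[of "f z"]] nz by (simp add: o_def)
  have eq: "complex_of_real (cmod (f z) powr \<alpha> * (0 * ln (cmod (f z)) + inner (a * v + b * cnj v) (sgn (f z)) * \<alpha> / cmod (f z)))
      = c * v + cnj c * cnj v" for v
  proof -
    have "inner (a * v + b * cnj v) (sgn (f z)) = Re (cnj (f z) * (a * v + b * cnj v)) / cmod (f z)"
      by (simp add: sgn_div_norm inner_complex_def divide_inverse algebra_simps)
    also have "Re (cnj (f z) * (a * v + b * cnj v)) = Re ((cnj (f z) * a + f z * cnj b) * v)"
      by (simp add: algebra_simps)
    finally have "cmod (f z) powr \<alpha> * (0 * ln (cmod (f z)) + inner (a * v + b * cnj v) (sgn (f z)) * \<alpha> / cmod (f z))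
       = 2 * ((\<alpha> / 2 * (cmod (f z) powr \<alpha> / (cmod (f z))\<^sup>2)) * Re ((cnj (f z) * a + f z * cnj b) * v))"
      by (simp add: power2_eq_square)
    also have "\<dots> = 2 * Re (c * v)" unfolding c_def mult.assoc by (subst Re_complex_of_real[symmetric]) (simp add: mult.assoc)
    finally show ?thesis by (metis complex_add_cnj complex_cnj_mult)
  qed
  have "((\<lambda>z. cmod (f z) powr \<alpha>) has_derivative
      (\<lambda>v. cmod (f z) powr \<alpha> * (0 * ln (cmod (f z)) + inner (a * v + b * cnj v) (sgn (f z)) * \<alpha> / cmod (f z)))) (at z)"
    by (rule has_derivative_powr[OF dn has_derivative_const]) (use nz in auto)
  then have "((\<lambda>z. complex_of_real (cmod (f z) powr \<alpha>)) has_derivative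
      (\<lambda>v. complex_of_real (cmod (f z) powr \<alpha> * (0 * ln (cmod (f z)) + inner (a * v + b * cnj v) (sgn (f z)) * \<alpha> / cmod (f z))))) (at z)"
    by (rule has_derivative_of_real)
  then show ?thesis unfolding eq .
qed

text \<open>The right-hand side is a quarter of the formal Laplacian of \<open>|f|\<^sup>2\<close> for a function with d-bar
  derivative \<open>|f|\<^sup>\<alpha> cnj h'\<close> and \<open>\<partial>f/\<partial>z = a\<close>; \<open>c\<close> is \<open>\<partial>|f|\<^sup>\<alpha>/\<partial>z\<close>. The bound follows by completing
  the square in \<open>|a|\<close>.\<close>

lemma Laplacian_lower_bound:
  fixes f a h' :: complex and \<alpha> :: real
  assumes \<alpha>: "0 < \<alpha>" "\<alpha> < 1" and nz: "f \<noteq> 0"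
  defines "m \<equiv> cmod f powr \<alpha>"
  defines "c \<equiv> of_real (\<alpha> / 2 * (m / (cmod f)\<^sup>2)) * (cnj f * a + f * cnj (of_real m * cnj h'))"
  shows "(1 + 3 / 4 * \<alpha>) * (m\<^sup>2 * (cmod h')\<^sup>2)
      \<le> 2 * Re (cnj f * (c * cnj h')) + (cmod a)\<^sup>2 + (cmod (of_real m * cnj h'))\<^sup>2"
proof -
  have m: "m > 0" using nz by (simp add: m_def)
  define n where "n = cmod f"
  have n: "n > 0" using nz by (simp add: n_def)
  have "cnj f * (c * cnj h') = of_real (\<alpha> / 2 * (m / n\<^sup>2)) * (cnj f * cnj f * a * cnj h' + of_real m * (f * cnj f) * (h' * cnj h'))"
  proof -
    have "c = of_real (\<alpha> / 2 * (m / n\<^sup>2)) * (cnj f * a + f * (of_real m * h'))"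
      by (simp add: c_def n_def)
    moreover have "x * (k * (x * a + y * (M * d)) * e) = k * (x * x * a * e + M * (y * x) * (d * e))"
      for x k y M d e :: complex by (simp add: algebra_simps)
    ultimately show ?thesis by metis
  qed
  also have "of_real m * (f * cnj f) * (h' * cnj h') = of_real (m * n\<^sup>2 * (cmod h')\<^sup>2)"
    by (simp only: of_real_mult n_def complex_norm_square)
  finally have "Re (cnj f * (c * cnj h')) = (\<alpha> / 2 * (m / n\<^sup>2)) * (Re (cnj f * cnj f * a * cnj h') + m * n\<^sup>2 * (cmod h')\<^sup>2)"
    by simp
  \<comment> \<open>The phase of the term containing \<open>a\<close> is unknown, so its real part
    is replaced by minus its modulus.\<close>
  also have "\<dots> \<ge> (\<alpha> / 2 * (m / n\<^sup>2)) * (- (n\<^sup>2 * cmod a * cmod h') + m * n\<^sup>2 * (cmod h')\<^sup>2)"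
  proof -
    have "\<bar>Re (cnj f * cnj f * a * cnj h')\<bar> \<le> cmod (cnj f * cnj f * a * cnj h')"
      by (rule abs_Re_le_cmod)
    also have "\<dots> = n\<^sup>2 * cmod a * cmod h'" by (simp add: norm_mult n_def power2_eq_square)
    finally show ?thesis using \<alpha> m by (intro mult_left_mono add_right_mono) auto
  qed
  also have "(\<alpha> / 2 * (m / n\<^sup>2)) * (- (n\<^sup>2 * cmod a * cmod h') + m * n\<^sup>2 * (cmod h')\<^sup>2)
      = \<alpha> / 2 * m * (m * (cmod h')\<^sup>2 - cmod a * cmod h')"
    using n by (simp add: field_simps)
  finally have "2 * Re (cnj f * (c * cnj h')) \<ge> \<alpha> * m * (m * (cmod h')\<^sup>2 - cmod a * cmod h')" by simp
  moreover have "(cmod (of_real m * cnj h'))\<^sup>2 = m\<^sup>2 * (cmod h')\<^sup>2"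
    by (simp add: norm_mult power_mult_distrib)
  moreover have "\<alpha> * m * (m * (cmod h')\<^sup>2 - cmod a * cmod h') + (cmod a)\<^sup>2 + m\<^sup>2 * (cmod h')\<^sup>2
     = (cmod a - \<alpha> * m * cmod h' / 2)\<^sup>2 + (1 + \<alpha> - \<alpha>\<^sup>2 / 4) * (m\<^sup>2 * (cmod h')\<^sup>2)"
    by (simp add: power2_eq_square algebra_simps)
  \<comment> \<open>The two constants differ by \<alpha>(1 - \<alpha>)/4; the one linear in \<alpha>
    keeps the later estimates simple.\<close>
  moreover have "(1 + 3 / 4 * \<alpha>) * (m\<^sup>2 * (cmod h')\<^sup>2) \<le> (1 + \<alpha> - \<alpha>\<^sup>2 / 4) * (m\<^sup>2 * (cmod h')\<^sup>2)"
    using \<alpha> by (intro mult_right_mono) (auto simp: power2_eq_square)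
  ultimately show ?thesis by (smt (verit) zero_le_power2)
qed

text \<open>With \<open>W = (C |h|\<^sup>2)\<^sup>\<beta>\<close>, a quarter of the Laplacian of \<open>W\<close> is \<open>(1 + 3\<alpha>/4) W\<^sup>\<alpha> |h'|\<^sup>2\<close>, whereas that of
  \<open>|f|\<^sup>2\<close> is at least \<open>(1 + 3\<alpha>/4) (|f|\<^sup>2)\<^sup>\<alpha> |h'|\<^sup>2\<close>, so \<open>|f|\<^sup>2 - W\<close> has no positive interior maximum.\<close>

lemma comparison_principle:
  fixes f h a :: "complex \<Rightarrow> complex" and \<alpha> \<rho> r :: real
  defines "C \<equiv> (1 + 3 / 4 * \<alpha>) * (1 - \<alpha>)\<^sup>2" and "\<beta> \<equiv> 1 / (1 - \<alpha>)"
  assumes \<alpha>: "0 < \<alpha>" "\<alpha> < 1" and \<rho>: "0 < \<rho>" "\<rho> < r"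
    and df: "\<And>z. z \<in> ball 0 r \<Longrightarrow>
      (f has_derivative (\<lambda>v. a z * v + of_real (cmod (f z) powr \<alpha>) * cnj (deriv h z) * cnj v)) (at z)"
    and ca: "continuous_on (ball 0 r) a"
    and holh: "h holomorphic_on ball 0 r" and h0: "h 0 = 0"
    and h': "\<And>z. norm z < \<rho> \<Longrightarrow> deriv h z \<noteq> 0"
    and bdry: "\<And>z. norm z = \<rho> \<Longrightarrow> (cmod (f z))\<^sup>2 < (C * (cmod (h z))\<^sup>2) powr \<beta>"
  shows "f 0 = 0"
proof (rule ccontr)
  assume f0: "f 0 \<noteq> 0"
  have C: "C > 0" using \<alpha> by (simp add: C_def add_pos_pos)
  have \<beta>: "\<beta> > 1" using \<alpha> by (simp add: \<beta>_def)
  have \<beta>\<alpha>: "\<beta> = \<alpha> * \<beta> + 1" using \<alpha> by (simp add: \<beta>_def field_simps)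
  define W where "W = (\<lambda>z. (C * (cmod (h z))\<^sup>2) powr \<beta>)"
  have sub: "cball 0 \<rho> \<subseteq> ball (0::complex) r" using \<rho> by auto
  have cf: "continuous_on (ball 0 r) f"
    by (meson df continuous_at_imp_continuous_on has_derivative_continuous)
  note ch = holomorphic_on_imp_continuous_on[OF holh]
  have cW: "continuous_on (ball 0 r) W"
    unfolding W_def by (intro continuous_on_powr' continuous_intros ch) (use C \<beta> in auto)
  have "continuous_on (cball 0 \<rho>) (\<lambda>z. (cmod (f z))\<^sup>2 - W z)"
    by (intro continuous_intros continuous_on_subset[OF cf sub] continuous_on_subset[OF cW sub])
  then obtain z0 where z0: "z0 \<in> cball 0 \<rho>"
    and max: "\<And>z. z \<in> cball 0 \<rho> \<Longrightarrow> (cmod (f z))\<^sup>2 - W z \<le> (cmod (f z0))\<^sup>2 - W z0"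
    using continuous_attains_sup[of "cball 0 \<rho>" "\<lambda>z. (cmod (f z))\<^sup>2 - W z"] \<rho> by auto
  \<comment> \<open>The barrier vanishes at the centre because h does, so
    \<open>f 0 \<noteq> 0\<close> makes the maximum positive.\<close>
  have "(cmod (f 0))\<^sup>2 - W 0 > 0" using f0 by (simp add: W_def h0)
  with max[of 0] \<rho> have gt: "(cmod (f z0))\<^sup>2 > W z0" by simp
  have z0\<rho>: "norm z0 < \<rho>"
    using z0 bdry[of z0] gt by (cases "norm z0 = \<rho>") (auto simp: W_def)
  have W0: "W z \<ge> 0" for z by (simp add: W_def)
  \<comment> \<open>This makes |f|^\<alpha>, and with it \<open>b\<close>, differentiable at the
    maximum point.\<close>
  have nz: "f z0 \<noteq> 0" using gt W0[of z0] by auto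
  have z0r: "z0 \<in> ball 0 r" using z0 sub by blast
  define m where "m = cmod (f z0) powr \<alpha>"
  define b where "b = (\<lambda>z. of_real (cmod (f z) powr \<alpha>) * cnj (deriv h z))"
  define c where "c = of_real (\<alpha> / 2 * (m / (cmod (f z0))\<^sup>2)) * (cnj (f z0) * a z0 + f z0 * cnj (of_real m * cnj (deriv h z0)))"
  have cb: "continuous_on (ball 0 r) b"
    unfolding b_def using \<alpha>
    by (intro continuous_intros continuous_on_powr' cf holomorphic_on_imp_continuous_on[OF holomorphic_deriv[OF holh]]) auto
  have db: "(b has_derivative (\<lambda>v. (c * cnj (deriv h z0)) * v +
       (cnj c * cnj (deriv h z0) + of_real m * cnj (deriv (deriv h) z0)) * cnj v)) (at z0)"
  proof -
    have "(deriv h has_field_derivative deriv (deriv h) z0) (at z0)"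
      by (rule holomorphic_derivI[OF holomorphic_deriv[OF holh] _ z0r]) auto
    then have "((\<lambda>z. cnj (deriv h z)) has_derivative (\<lambda>v. cnj (deriv (deriv h) z0 * v))) (at z0)"
      by (intro has_derivative_cnj) (simp add: has_field_derivative_def)
    from has_derivative_mult[OF cmod_powr_has_derivative[OF df[OF z0r] nz, where \<alpha>=\<alpha>] this]
    show ?thesis
      by (simp add: b_def c_def m_def algebra_simps)
  qed
  have low: "(1 + 3 / 4 * \<alpha>) * (m\<^sup>2 * (cmod (deriv h z0))\<^sup>2)
      \<le> 2 * Re (cnj (f z0) * (c * cnj (deriv h z0))) + (cmod (a z0))\<^sup>2 + (cmod (b z0))\<^sup>2"
    using Laplacian_lower_bound[OF \<alpha> nz, where a = "a z0" and h' = "deriv h z0"] by (simp add: c_def m_def b_def)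
  \<comment> \<open>\<open>W\<close> itself may fail to be smooth. A holomorphic \<open>H\<close>
    whose squared modulus touches \<open>W\<close> from above at \<open>z0\<close> inherits the
    local maximum and can be used in its place.\<close>
  have majorant: "(1 + 3 / 4 * \<alpha>) * (m\<^sup>2 * (cmod (deriv h z0))\<^sup>2) \<le> (cmod (deriv H z0))\<^sup>2"
    if \<delta>: "\<delta> > 0" and H: "H holomorphic_on ball z0 \<delta>" and HW: "\<And>z. z \<in> ball z0 \<delta> \<Longrightarrow> W z \<le> (cmod (H z))\<^sup>2"
      and HW0: "(cmod (H z0))\<^sup>2 = W z0" for \<delta> H
  proof -
    define \<delta>' where "\<delta>' = min \<delta> (\<rho> - norm z0)"
    have \<delta>': "\<delta>' > 0" using \<delta> z0\<rho> by (simp add: \<delta>'_def)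
    have s1: "ball z0 \<delta>' \<subseteq> ball z0 \<delta>" by (auto simp: \<delta>'_def)
    have s2: "ball z0 \<delta>' \<subseteq> cball 0 \<rho>"
    proof
      fix y assume "y \<in> ball z0 \<delta>'"
      then have "norm (y - z0) < \<rho> - norm z0" by (simp add: \<delta>'_def dist_norm norm_minus_commute)
      then show "y \<in> cball 0 \<rho>" using norm_triangle_sub[of y z0] by simp
    qed
    have s3: "ball z0 \<delta>' \<subseteq> ball 0 r" using s2 sub by blast
    have "2 * Re (cnj (f z0) * (c * cnj (deriv h z0))) + (cmod (a z0))\<^sup>2 + (cmod (b z0))\<^sup>2 \<le> (cmod (deriv H z0))\<^sup>2"
    proof (rule local_max_norm2_diff_holomorphic[OF \<delta>' _ _ _ db])
      show "(f has_derivative (\<lambda>v. a z * v + b z * cnj v)) (at z)" if "z \<in> ball z0 \<delta>'" for z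
        using df[of z] that s3 by (auto simp: b_def)
      show "(cmod (f z))\<^sup>2 - (cmod (H z))\<^sup>2 \<le> (cmod (f z0))\<^sup>2 - (cmod (H z0))\<^sup>2" if "z \<in> ball z0 \<delta>'" for z
        using max[of z] HW[of z] HW0 that s1 s2 by (auto simp: subset_iff)
    qed (use continuous_on_subset[OF ca s3] continuous_on_subset[OF cb s3] holomorphic_on_subset[OF H s1] in auto)
    with low show ?thesis by linarith
  qed
  have D: "deriv h z0 \<noteq> 0" by (rule h'[OF z0\<rho>])
  have dh: "(h has_field_derivative deriv h z0) (at z0)"
    by (rule holomorphic_derivI[OF holh _ z0r]) auto
  have h_tendsto: "(h \<longlongrightarrow> h z0) (at z0)"
    using DERIV_isCont[OF dh] by (simp add: isCont_def)
  have at_to_nhds: "\<exists>\<delta>>0. ball z0 \<delta> \<subseteq> ball 0 r \<and> (\<forall>z\<in>ball z0 \<delta>. P z)"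
    if "eventually P (at z0)" "P z0" for P
  proof -
    have "eventually P (nhds z0)" using that by (simp add: eventually_nhds_conv_at)
    moreover have "eventually (\<lambda>z. z \<in> ball 0 r) (nhds z0)" using z0r by (intro eventually_nhds_in_open) auto
    ultimately have "eventually (\<lambda>z. z \<in> ball 0 r \<and> P z) (nhds z0)" by eventually_elim auto
    then show ?thesis unfolding eventually_nhds_metric by (auto simp: dist_commute subset_iff)
  qed
  have m0: "m > 0" using nz by (simp add: m_def)
  show False
  proof (cases "h z0 = 0")
    case True
    \<comment> \<open>\<open>W\<close> need not be the squared modulus of a holomorphic function at a zero of \<open>h\<close>, but \<open>\<beta> > 1\<close>
      makes it smaller than any multiple of \<open>|h|\<^sup>2\<close>.\<close>
    define \<eta> where "\<eta> = m / 2"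
    have "((\<lambda>z. C powr \<beta> * ((cmod (h z))\<^sup>2) powr (\<beta> - 1)) \<longlongrightarrow> C powr \<beta> * ((cmod (h z0))\<^sup>2) powr (\<beta> - 1)) (at z0)"
      by (intro tendsto_intros tendsto_powr' h_tendsto) (use \<beta> in auto)
    then have "\<forall>\<^sub>F z in at z0. C powr \<beta> * ((cmod (h z))\<^sup>2) powr (\<beta> - 1) < \<eta>\<^sup>2"
      by (rule order_tendstoD) (use m0 True in \<open>auto simp: \<eta>_def\<close>)
    then obtain \<delta> where \<delta>: "\<delta> > 0" "ball z0 \<delta> \<subseteq> ball 0 r"
      "\<And>z. z \<in> ball z0 \<delta> \<Longrightarrow> C powr \<beta> * ((cmod (h z))\<^sup>2) powr (\<beta> - 1) < \<eta>\<^sup>2"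
      using at_to_nhds[of "\<lambda>z. C powr \<beta> * ((cmod (h z))\<^sup>2) powr (\<beta> - 1) < \<eta>\<^sup>2"] True m0 by (auto simp: \<eta>_def)
    have "(1 + 3 / 4 * \<alpha>) * (m\<^sup>2 * (cmod (deriv h z0))\<^sup>2) \<le> (cmod (deriv (\<lambda>z. of_real \<eta> * h z) z0))\<^sup>2"
    proof (rule majorant[OF \<delta>(1)])
      show "(\<lambda>z. of_real \<eta> * h z) holomorphic_on ball z0 \<delta>"
        by (intro holomorphic_intros holomorphic_on_subset[OF holh \<delta>(2)])
      fix z assume z: "z \<in> ball z0 \<delta>"
      have "W z = C powr \<beta> * ((cmod (h z))\<^sup>2) powr (\<beta> - 1) * (cmod (h z))\<^sup>2"
      proof (cases "h z = 0")
        case False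
        then have "((cmod (h z))\<^sup>2) powr \<beta> = ((cmod (h z))\<^sup>2) powr (\<beta> - 1) * (cmod (h z))\<^sup>2"
          using powr_add[of "(cmod (h z))\<^sup>2" "\<beta> - 1" 1] by simp
        then show ?thesis using C by (simp add: W_def powr_mult)
      qed (simp add: W_def)
      also have "\<dots> \<le> \<eta>\<^sup>2 * (cmod (h z))\<^sup>2"
        using \<delta>(3)[OF z] by (intro mult_right_mono) auto
      finally show "W z \<le> (cmod (of_real \<eta> * h z))\<^sup>2" by (simp add: norm_mult power_mult_distrib)
    qed (simp add: True W_def)
    also have "deriv (\<lambda>z. of_real \<eta> * h z) z0 = of_real \<eta> * deriv h z0"
      using dh by (intro DERIV_imp_deriv DERIV_cmult)
    also have "(cmod \<dots>)\<^sup>2 = 1 / 4 * (m\<^sup>2 * (cmod (deriv h z0))\<^sup>2)"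
      by (simp add: norm_mult power_mult_distrib \<eta>_def power_divide)
    finally have "(1 + 3 / 4 * \<alpha>) * (m\<^sup>2 * (cmod (deriv h z0))\<^sup>2) \<le> 1 / 4 * (m\<^sup>2 * (cmod (deriv h z0))\<^sup>2)" .
    moreover have "m\<^sup>2 * (cmod (deriv h z0))\<^sup>2 > 0" using m0 D by simp
    ultimately have "1 + 3 / 4 * \<alpha> \<le> 1 / 4" by (simp only: mult_le_cancel_right)
    then show False using \<alpha> by simp
  next
    case False
    \<comment> \<open>Locally \<open>W\<close> is the squared modulus of a branch of a constant times \<open>h\<^sup>\<beta>\<close>.\<close>
    define H where "H = (\<lambda>z. of_real (sqrt (W z0)) * exp (of_real \<beta> * Ln (h z / h z0)))"
    have "((\<lambda>z. h z / h z0) \<longlongrightarrow> h z0 / h z0) (at z0)"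
      by (intro tendsto_intros h_tendsto False)
    then have "\<forall>\<^sub>F z in at z0. dist (h z / h z0) 1 < 1"
      using False by (intro tendstoD) auto
    then obtain \<delta> where \<delta>: "\<delta> > 0" "ball z0 \<delta> \<subseteq> ball 0 r"
      "\<And>z. z \<in> ball z0 \<delta> \<Longrightarrow> dist (h z / h z0) 1 < 1"
      using at_to_nhds[of "\<lambda>z. dist (h z / h z0) 1 < 1"] False by auto
    \<comment> \<open>Staying in the right half-plane keeps the quotient off the branch cut of
      \<open>Ln\<close>.\<close>
    have pos: "Re (h z / h z0) > 0" if "z \<in> ball z0 \<delta>" for z
    proof -
      have "\<bar>Re (h z / h z0 - 1)\<bar> < 1"
        using \<delta>(3)[OF that] abs_Re_le_cmod[of "h z / h z0 - 1"] by (simp add: dist_norm)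
      then show ?thesis by simp
    qed
    define X where "X = C * (cmod (h z0))\<^sup>2"
    have X: "X > 0" using C False by (simp add: X_def)
    have holH: "H holomorphic_on ball z0 \<delta>"
      unfolding H_def
      by (intro holomorphic_intros holomorphic_on_subset[OF holh \<delta>(2)] False) (use pos in \<open>auto simp: complex_nonpos_Reals_iff\<close>, force+)
    have HW: "(cmod (H z))\<^sup>2 = W z" if z: "z \<in> ball z0 \<delta>" for z
    proof -
      define q where "q = h z / h z0"
      have q: "q \<noteq> 0" using pos[OF z] by (auto simp: q_def)
      have "(cmod (H z))\<^sup>2 = W z0 * (exp (\<beta> * ln (cmod q)))\<^sup>2"
        using q W0[of z0] by (simp add: H_def norm_mult power_mult_distrib flip: q_def)
      also have "(exp (\<beta> * ln (cmod q)))\<^sup>2 = ((cmod q)\<^sup>2) powr \<beta>"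
        using q by (simp add: powr_def ln_realpow flip: exp_double) 
      also have "W z0 * \<dots> = (X * (cmod q)\<^sup>2) powr \<beta>"
        using X by (simp add: W_def X_def powr_mult)
      also have "X * (cmod q)\<^sup>2 = C * (cmod (h z))\<^sup>2"
        using False by (simp add: X_def q_def norm_divide power_divide)
      finally show ?thesis by (simp add: W_def)
    qed
    have "(1 + 3 / 4 * \<alpha>) * (m\<^sup>2 * (cmod (deriv h z0))\<^sup>2) \<le> (cmod (deriv H z0))\<^sup>2"
      by (rule majorant[OF \<delta>(1) holH]) (use HW \<delta>(1) in auto)
    also have "deriv H z0 = of_real (sqrt (W z0)) * (of_real \<beta> * (deriv h z0 / h z0))"
      unfolding H_def using False
      by (intro DERIV_imp_deriv) (auto intro!: derivative_eq_intros dh)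
    also have "(cmod \<dots>)\<^sup>2 = W z0 * \<beta>\<^sup>2 / (cmod (h z0))\<^sup>2 * (cmod (deriv h z0))\<^sup>2"
      using W0[of z0] by (simp add: norm_mult norm_divide power_mult_distrib power_divide)
    \<comment> \<open>The choices of \<beta> and \<open>C\<close> enter here: \<beta> - 1 =
      \<alpha>\<beta> turns X^(\<beta>-1) into W^\<alpha>, and C \<beta>^2 = 1 +
      3\<alpha>/4.\<close>
    also have "W z0 * \<beta>\<^sup>2 / (cmod (h z0))\<^sup>2 = (1 + 3 / 4 * \<alpha>) * W z0 powr \<alpha>"
    proof -
      have "W z0 = X powr (\<alpha> * \<beta>) * X"
        using X \<beta>\<alpha> powr_add[of X "\<alpha> * \<beta>" 1] by (simp add: W_def X_def)
      moreover have "X powr (\<alpha> * \<beta>) = W z0 powr \<alpha>"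
        by (simp add: W_def X_def powr_powr mult.commute)
      moreover define w where "w = W z0 powr \<alpha>"
      ultimately have "W z0 = w * (C * (cmod (h z0))\<^sup>2)" by (simp add: X_def)
      then have "W z0 * \<beta>\<^sup>2 / (cmod (h z0))\<^sup>2 = w * (C * \<beta>\<^sup>2)"
        using False by simp
      also have "C * \<beta>\<^sup>2 = 1 + 3 / 4 * \<alpha>" using \<alpha> by (simp add: C_def \<beta>_def power_divide)
      finally show ?thesis by (simp only: mult.commute w_def)
    qed
    finally have "((1 + 3 / 4 * \<alpha>) * (cmod (deriv h z0))\<^sup>2) * m\<^sup>2 \<le> ((1 + 3 / 4 * \<alpha>) * (cmod (deriv h z0))\<^sup>2) * W z0 powr \<alpha>"
      by (simp only: mult_ac)
    moreover have "(1 + 3 / 4 * \<alpha>) * (cmod (deriv h z0))\<^sup>2 > 0" using \<alpha> D by simp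
    ultimately have "m\<^sup>2 \<le> W z0 powr \<alpha>" by (simp only: mult_le_cancel_left_pos)
    moreover have "m\<^sup>2 = ((cmod (f z0))\<^sup>2) powr \<alpha>"
      using nz by (simp add: m_def power2_eq_square powr_mult)
    moreover have "W z0 powr \<alpha> < ((cmod (f z0))\<^sup>2) powr \<alpha>"
      using gt W0[of z0] \<alpha> by (intro powr_less_mono2) auto
    ultimately show False by simp
  qed
qed

section \<open>Pseudoholomorphic disks\<close>

text \<open>The right-hand side is the barrier at |h| = 8/5. Both sides are powers with exponent
  1/(1-\<alpha>), so only the bases need comparing; divided by (1-\<alpha>)^2, they tend to 4 and
  4.48 as \<alpha> tends to 1.\<close>

lemma S_crit_square_le:
  assumes \<alpha>: "0 < \<alpha>" "\<alpha> < 1"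
  shows "(S_crit \<alpha>)\<^sup>2 \<le> (((1 + 3 / 4 * \<alpha>) * (1 - \<alpha>)\<^sup>2) * (8 / 5)\<^sup>2) powr (1 / (1 - \<alpha>))"
proof -
  define K where "K = (if \<alpha> \<le> 2 / 3 then \<alpha> * (1 - \<alpha>) else 4 * \<alpha> * (1 - \<alpha>)\<^sup>2 / (2 - \<alpha>))"
  have K: "K \<ge> 0" using \<alpha> by (simp add: K_def)
  have "1 / (2 - 2 * \<alpha>) + 1 / (2 - 2 * \<alpha>) = 1 / (1 - \<alpha>)" using \<alpha> by (simp add: field_simps)
  then have "(S_crit \<alpha>)\<^sup>2 = K powr (1 / (1 - \<alpha>))"
    by (simp add: S_crit_def K_def power2_eq_square flip: powr_add)
  also have "\<dots> \<le> (((1 + 3 / 4 * \<alpha>) * (1 - \<alpha>)\<^sup>2) * (8 / 5)\<^sup>2) powr (1 / (1 - \<alpha>))"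
  proof (rule powr_mono2)
    show "K \<le> ((1 + 3 / 4 * \<alpha>) * (1 - \<alpha>)\<^sup>2) * (8 / 5)\<^sup>2"
    proof (cases "\<alpha> \<le> 2 / 3")
      case True
      have "\<alpha> \<le> (1 + 3 / 4 * \<alpha>) * (1/3) * (8/5)\<^sup>2" using True by (simp add: power2_eq_square)
      also have "\<dots> \<le> (1 + 3 / 4 * \<alpha>) * (1 - \<alpha>) * (8/5)\<^sup>2"
        using True \<alpha> by (intro mult_right_mono mult_left_mono) auto
      finally have "\<alpha> * (1 - \<alpha>) \<le> (1 + 3 / 4 * \<alpha>) * (1 - \<alpha>) * (8/5)\<^sup>2 * (1 - \<alpha>)"
        using \<alpha> by (intro mult_right_mono) auto
      then show ?thesis using True by (simp add: K_def power2_eq_square mult_ac)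
    next
      case False
      have "\<alpha> * \<alpha> \<le> \<alpha>" using \<alpha> by simp
      moreover have "(1 + 3 / 4 * \<alpha>) * (8/5)\<^sup>2 * (2 - \<alpha>) = 128 / 25 + 32 / 25 * \<alpha> - 48 / 25 * (\<alpha> * \<alpha>)"
        by (simp add: power2_eq_square field_simps)
      ultimately have "4 * \<alpha> \<le> (1 + 3 / 4 * \<alpha>) * (8/5)\<^sup>2 * (2 - \<alpha>)"
        using \<alpha> by linarith
      then have "4 * \<alpha> / (2 - \<alpha>) \<le> (1 + 3 / 4 * \<alpha>) * (8/5)\<^sup>2" using \<alpha> by (simp add: divide_le_eq)
      then have "4 * \<alpha> / (2 - \<alpha>) * (1 - \<alpha>)\<^sup>2 \<le> (1 + 3 / 4 * \<alpha>) * (8/5)\<^sup>2 * (1 - \<alpha>)\<^sup>2"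
        by (intro mult_right_mono) auto
      then show ?thesis using False by (simp add: K_def mult_ac)
    qed
  qed (use \<alpha> K in auto)
  finally show ?thesis .
qed

lemma S_crit_pos: "0 < \<alpha> \<Longrightarrow> \<alpha> < 1 \<Longrightarrow> S_crit \<alpha> > 0"
  by (auto simp: S_crit_def)

section \<open>From the matrix J to the d-bar system\<close>

lemma bounded_linear_z1: "bounded_linear z1"
  by (rule linear_conv_bounded_linear[THEN iffD1], rule linearI) (auto simp: z1_def complex_eq_iff)

lemma bounded_linear_z2: "bounded_linear z2"
  by (rule linear_conv_bounded_linear[THEN iffD1], rule linearI) (auto simp: z2_def complex_eq_iff)

text \<open>The upper rows of J give the Cauchy-Riemann equations for h = z1 o Z. The lower left
  block sends w to i \<lambda> cnj w, so f = z2 o Z satisfies f_y = i f_x + i \<lambda> cnj h', that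
  is, its d-bar derivative is -(\<lambda>/2) cnj h'. The factor -2 in \<open>lambda_alpha\<close>
  normalises this to |f|^\<alpha> cnj h'.\<close>

lemma J_holomorphic_disk_equations:
  assumes disk: "J_holomorphic_disk \<Omega> (J_mat (lambda_alpha \<alpha>)) r Z" and \<alpha>: "0 < \<alpha>"
  obtains a where "continuous_on (ball 0 r) a"
    and "(z1 \<circ> Z) holomorphic_on ball 0 r"
    and "\<And>z. z \<in> ball 0 r \<Longrightarrow> deriv (z1 \<circ> Z) z = z1 (frechet_derivative Z (at z) 1)"
    and "\<And>z. z \<in> ball 0 r \<Longrightarrow> ((z2 \<circ> Z) has_derivative
       (\<lambda>v. a z * v + of_real (cmod ((z2 \<circ> Z) z) powr \<alpha>) * cnj (deriv (z1 \<circ> Z) z) * cnj v)) (at z)"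
proof -
  have ball: "disk r = ball 0 r" by (auto simp: disk_def)
  obtain Z' where dZ: "\<And>z. z \<in> ball 0 r \<Longrightarrow> (Z has_derivative blinfun_apply (Z' z)) (at z)"
    and cZ': "continuous_on (ball 0 r) Z'"
    using disk unfolding J_holomorphic_disk_def C1_on_def ball by blast
  have fZ: "frechet_derivative Z (at z) = blinfun_apply (Z' z)" if "z \<in> ball 0 r" for z
    using frechet_derivative_at[OF dZ[OF that]] by simp
  define p where "p = (\<lambda>z. blinfun_apply (Z' z) 1)"
  have J: "blinfun_apply (Z' z) \<i> = J_mat (lambda_alpha \<alpha>) (Z z) *v p z" if "z \<in> ball 0 r" for z
  proof -
    have "(frechet_derivative Z (at z) \<circ> J_std) 1 = ((\<lambda>v. J_mat (lambda_alpha \<alpha>) (Z z) *v v) \<circ> frechet_derivative Z (at z)) 1"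
      using disk that by (simp add: J_holomorphic_disk_def ball)
    then show ?thesis by (simp add: fZ[OF that] p_def J_std_def)
  qed
  have lin: "blinfun_apply (Z' z) v = Re v *\<^sub>R p z + Im v *\<^sub>R (J_mat (lambda_alpha \<alpha>) (Z z) *v p z)"
    if "z \<in> ball 0 r" for z v
  proof -
    have "blinfun_apply (Z' z) v = blinfun_apply (Z' z) (Re v *\<^sub>R 1 + Im v *\<^sub>R \<i>)"
      by (rule arg_cong[where f = "blinfun_apply (Z' z)"]) (simp add: complex_eq_iff)
    then show ?thesis by (simp add: blinfun.add_right blinfun.scaleR_right J[OF that] p_def)
  qed
  have d1: "((z1 \<circ> Z) has_field_derivative z1 (p z)) (at z)" if z: "z \<in> ball 0 r" for z
  proof -
    have "z1 (blinfun_apply (Z' z) v) = z1 (p z) * v" for v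
      by (simp add: lin[OF z] z1_def J_mat_def matrix_vector_mult_def sum_4 complex_eq_iff algebra_simps)
    then show ?thesis
      using bounded_linear.has_derivative[OF bounded_linear_z1 dZ[OF z]]
      by (simp add: has_field_derivative_def o_def)
  qed
  \<comment> \<open>The x-derivative is the sum of the two Wirtinger derivatives, so
    \<open>a\<close> is f_x minus the d-bar derivative.\<close>
  define a where "a = (\<lambda>z. z2 (p z) - of_real (cmod ((z2 \<circ> Z) z) powr \<alpha>) * cnj (z1 (p z)))"
  have cZ: "continuous_on (ball 0 r) Z"
    by (meson dZ continuous_at_imp_continuous_on has_derivative_continuous)
  have cp: "continuous_on (ball 0 r) p"
    unfolding p_def by (intro continuous_intros cZ')
  have ca: "continuous_on (ball 0 r) a"
    unfolding a_def o_def using \<alpha>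
    by (intro continuous_intros continuous_on_powr' bounded_linear.continuous_on[OF bounded_linear_z1]
        bounded_linear.continuous_on[OF bounded_linear_z2] cp cZ) auto
  have d2: "((z2 \<circ> Z) has_derivative
       (\<lambda>v. a z * v + of_real (cmod ((z2 \<circ> Z) z) powr \<alpha>) * cnj (z1 (p z)) * cnj v)) (at z)" if z: "z \<in> ball 0 r" for z
  proof -
    have "z2 (blinfun_apply (Z' z) v) = a z * v + of_real (cmod ((z2 \<circ> Z) z) powr \<alpha>) * cnj (z1 (p z)) * cnj v" for v
      by (simp add: lin[OF z] a_def z1_def z2_def lambda_alpha_def J_mat_def matrix_vector_mult_def sum_4 complex_eq_iff algebra_simps)
    then show ?thesis
      using bounded_linear.has_derivative[OF bounded_linear_z2 dZ[OF z]] by (simp add: o_def)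
  qed
  show ?thesis
  proof (rule that[OF ca])
    show "(z1 \<circ> Z) holomorphic_on ball 0 r"
      unfolding holomorphic_on_open[OF open_ball] using d1 by blast
    show "deriv (z1 \<circ> Z) z = z1 (frechet_derivative Z (at z) 1)" if "z \<in> ball 0 r" for z
      using DERIV_imp_deriv[OF d1[OF that]] fZ[OF that] by (simp add: p_def)
    show "((z2 \<circ> Z) has_derivative
       (\<lambda>v. a z * v + of_real (cmod ((z2 \<circ> Z) z) powr \<alpha>) * cnj (deriv (z1 \<circ> Z) z) * cnj v)) (at z)" if "z \<in> ball 0 r" for z
      using d2[OF that] DERIV_imp_deriv[OF d1[OF that]] by simp
  qed
qed

lemma J_holomorphic_disk_radius_le:
  assumes \<alpha>: "0 < \<alpha>" "\<alpha> < 1"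
    and disk: "J_holomorphic_disk (Omega (S_crit \<alpha>)) (J_mat (lambda_alpha \<alpha>)) r Z"
    and z1: "z1 (Z 0) = 0" "z1 (frechet_derivative Z (at 0) 1) = 1" and z2: "z2 (Z 0) \<noteq> 0"
  shows "r \<le> 999 / 500"
proof (rule ccontr)
  assume "\<not> r \<le> 999 / 500"
  then have r: "r > 999 / 500" by simp
  have Om: "Z z \<in> Omega (S_crit \<alpha>)" if "z \<in> ball 0 r" for z
    using disk that by (auto simp: J_holomorphic_disk_def disk_def)
  obtain a where ca: "continuous_on (ball 0 r) a"
    and hol: "(z1 \<circ> Z) holomorphic_on ball 0 r"
    and deriv: "\<And>z. z \<in> ball 0 r \<Longrightarrow> deriv (z1 \<circ> Z) z = z1 (frechet_derivative Z (at z) 1)"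
    and df: "\<And>z. z \<in> ball 0 r \<Longrightarrow> ((z2 \<circ> Z) has_derivative
       (\<lambda>v. a z * v + of_real (cmod ((z2 \<circ> Z) z) powr \<alpha>) * cnj (deriv (z1 \<circ> Z) z) * cnj v)) (at z)"
    using J_holomorphic_disk_equations[OF disk \<alpha>(1)] by blast
  have h: "norm ((z1 \<circ> Z) z) < 2" if "z \<in> ball 0 r" for z
    using Om[OF that] by (simp add: Omega_def disk_def)
  have h0: "(z1 \<circ> Z) 0 = 0" "deriv (z1 \<circ> Z) 0 = 1" using z1 r deriv[of 0] by auto
  have "(z2 \<circ> Z) 0 = 0"
  proof (rule comparison_principle[OF \<alpha> _ _ df ca hol h0(1)])
    \<comment> \<open>The radius 17/10 leaves the margin 1/10 that the Cauchy estimate needs inside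
      |z| <= 9/5.\<close>
    show "deriv (z1 \<circ> Z) z \<noteq> 0" if "norm z < 17/10" for z
      using near_identity_deriv[OF hol r h h0, of z] that by simp
    show "(cmod ((z2 \<circ> Z) z))\<^sup>2 < ((1 + 3 / 4 * \<alpha>) * (1 - \<alpha>)\<^sup>2 * (cmod ((z1 \<circ> Z) z))\<^sup>2) powr (1 / (1 - \<alpha>))"
      if z: "norm z = 17/10" for z
    proof -
      have "norm ((z1 \<circ> Z) z - z) \<le> norm z / 40"
        using near_identity[OF hol r h h0, of z] z by simp
      \<comment> \<open>The bound is 17/10 - 17/400 = 1.6575.\<close>
      then have "8 / 5 \<le> cmod ((z1 \<circ> Z) z)"
        using norm_triangle_ineq3[of "(z1 \<circ> Z) z" z] z by simp
      then have sq: "(8 / 5)\<^sup>2 \<le> (cmod ((z1 \<circ> Z) z))\<^sup>2" by (intro power_mono) auto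
      have "cmod ((z2 \<circ> Z) z) < S_crit \<alpha>" using Om[of z] z r by (simp add: Omega_def disk_def)
      then have "(cmod ((z2 \<circ> Z) z))\<^sup>2 < (S_crit \<alpha>)\<^sup>2" by (intro power_strict_mono) auto
      also have "\<dots> \<le> (((1 + 3 / 4 * \<alpha>) * (1 - \<alpha>)\<^sup>2) * (8 / 5)\<^sup>2) powr (1 / (1 - \<alpha>))"
        by (rule S_crit_square_le[OF \<alpha>])
      also have "\<dots> \<le> ((1 + 3 / 4 * \<alpha>) * (1 - \<alpha>)\<^sup>2 * (cmod ((z1 \<circ> Z) z))\<^sup>2) powr (1 / (1 - \<alpha>))"
        using \<alpha> sq by (intro powr_mono2 mult_left_mono) auto
      finally show ?thesis .
    qed
  qed (use r in auto)
  with z2 show False by simp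
qed

section \<open>Explicit disks from an ordinary differential equation\<close>

text \<open>With h the identity and f depending on Re z alone, the d-bar derivative of f is g'/2, so
  the disk equation becomes g' = 2 g^\<alpha>.\<close>

lemma J_holomorphic_disk_of_ODE:
  fixes g :: "real \<Rightarrow> real"
  assumes r: "0 < r" "r \<le> 2" and \<alpha>: "0 < \<alpha>"
    and dg: "\<And>x. \<bar>x\<bar> < r \<Longrightarrow> (g has_real_derivative 2 * g x powr \<alpha>) (at x)"
    and g: "\<And>x. \<bar>x\<bar> < r \<Longrightarrow> 0 \<le> g x \<and> g x < S"
  defines "Z \<equiv> (\<lambda>z. vector [Re z, Im z, g (Re z), 0] :: real^4)"
  shows "J_holomorphic_disk (Omega S) (J_mat (lambda_alpha \<alpha>)) r Z"
    and "frechet_derivative Z (at 0) 1 = vector [1, 0, 2 * g 0 powr \<alpha>, 0]"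
proof -
  have Re: "\<bar>Re z\<bar> < r" if "z \<in> disk r" for z
    using that abs_Re_le_cmod[of z] by (simp add: disk_def)
  \<comment> \<open>Writing the derivative as a fixed operator plus a scalar multiple of another
    reduces its continuity in operator norm to that of the scalar.\<close>
  define A where "A = (\<lambda>v. vector [Re v, Im v, 0, 0] :: real^4)"
  define B where "B = (\<lambda>v. vector [0, 0, Re v, 0] :: real^4)"
  have A: "bounded_linear A" and B: "bounded_linear B"
    by (rule linear_conv_bounded_linear[THEN iffD1], rule linearI; simp add: A_def B_def vec_eq_iff forall_4)+
  define Z' where "Z' = (\<lambda>z. Blinfun A + (2 * g (Re z) powr \<alpha>) *\<^sub>R Blinfun B)"
  have Z': "blinfun_apply (Z' z) v = vector [Re v, Im v, 2 * g (Re z) powr \<alpha> * Re v, 0]" for z v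
    by (simp add: Z'_def blinfun.add_left blinfun.scaleR_left bounded_linear_Blinfun_apply A B)
       (simp add: A_def B_def vec_eq_iff forall_4)
  have dZ: "(Z has_derivative blinfun_apply (Z' z)) (at z)" if z: "z \<in> disk r" for z
  proof -
    have "((\<lambda>z. g (Re z)) has_derivative (\<lambda>v. 2 * g (Re z) powr \<alpha> * Re v)) (at z)"
      using has_derivative_compose[of Re Re z UNIV g "(*) (2 * g (Re z) powr \<alpha>)"] dg[OF Re[OF z]]
        bounded_linear_imp_has_derivative[OF bounded_linear_Re]
      by (simp add: has_field_derivative_def)
    then have "((\<lambda>z. A z + g (Re z) *\<^sub>R axis 3 1) has_derivative (\<lambda>v. A v + (2 * g (Re z) powr \<alpha> * Re v) *\<^sub>R axis 3 1)) (at z)"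
      by (intro has_derivative_add has_derivative_scaleR_left bounded_linear_imp_has_derivative A)
    moreover have "Z = (\<lambda>z. A z + g (Re z) *\<^sub>R axis 3 1)"
      by (simp add: Z_def A_def vec_eq_iff forall_4 fun_eq_iff axis_def)
    moreover have "blinfun_apply (Z' z) = (\<lambda>v. A v + (2 * g (Re z) powr \<alpha> * Re v) *\<^sub>R axis 3 1)"
      by (simp add: Z' A_def vec_eq_iff forall_4 fun_eq_iff axis_def)
    ultimately show ?thesis by simp
  qed
  have fZ: "frechet_derivative Z (at z) = blinfun_apply (Z' z)" if "z \<in> disk r" for z
    using frechet_derivative_at[OF dZ[OF that]] by simp
  have "continuous_on {x. \<bar>x\<bar> < r} g"
    using dg by (auto intro!: continuous_at_imp_continuous_on DERIV_isCont)
  then have "continuous_on (disk r) (\<lambda>z. g (Re z))"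
    by (rule continuous_on_compose2) (use Re in \<open>auto intro!: continuous_intros\<close>)
  then have "continuous_on (disk r) Z'"
    unfolding Z'_def using \<alpha> g[OF Re] by (intro continuous_intros continuous_on_powr') auto
  then have C1: "C1_on Z (disk r)" unfolding C1_on_def using dZ by blast
  have img: "Z z \<in> Omega S" if z: "z \<in> disk r" for z
    using g[OF Re[OF z]] z r by (auto simp: Omega_def Z_def z1_def z2_def disk_def cmod_def)
  have J: "frechet_derivative Z (at z) \<circ> J_std = (\<lambda>v. J_mat (lambda_alpha \<alpha>) (Z z) *v v) \<circ> frechet_derivative Z (at z)"
    if z: "z \<in> disk r" for z
  proof -
    have "lambda_alpha \<alpha> (Z z) = - 2 * g (Re z) powr \<alpha>"
      using g[OF Re[OF z]] by (simp add: lambda_alpha_def Z_def z2_def cmod_def)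
    then show ?thesis
      by (simp add: fZ[OF z] fun_eq_iff Z' J_std_def J_mat_def vec_eq_iff forall_4 matrix_vector_mult_def sum_4)
  qed
  show "J_holomorphic_disk (Omega S) (J_mat (lambda_alpha \<alpha>)) r Z"
    using img C1 J by (auto simp: J_holomorphic_disk_def)
  show "frechet_derivative Z (at 0) 1 = vector [1, 0, 2 * g 0 powr \<alpha>, 0]"
    using r by (simp add: fZ disk_def Z')
qed

lemma J_holomorphic_disk_exists:
  assumes \<alpha>: "0 < \<alpha>" "\<alpha> < 1" and b: "0 < b" "b < S"
  obtains r Z where "r > 0" "J_holomorphic_disk (Omega S) (J_mat (lambda_alpha \<alpha>)) r Z"
    "Z 0 = vector [0, 0, b, 0]" "frechet_derivative Z (at 0) 1 = vector [1, 0, 2 * b powr \<alpha>, 0]"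
proof -
  \<comment> \<open>Separation of variables: g^(1-\<alpha>) is affine with slope
    2(1-\<alpha>).\<close>
  define k where "k = (\<lambda>x. 2 * (1 - \<alpha>) * x + b powr (1 - \<alpha>))"
  define g where "g = (\<lambda>x. k x powr (1 / (1 - \<alpha>)))"
  have g0: "g 0 = b" using \<alpha> b by (simp add: g_def k_def powr_powr)
  have dg: "(g has_real_derivative 2 * g x powr \<alpha>) (at x)" if "k x > 0" for x
  proof -
    have "(k has_real_derivative 2 * (1 - \<alpha>)) (at x)"
      unfolding k_def by (auto intro!: derivative_eq_intros)
    from DERIV_fun_powr[OF this that, of "1 / (1 - \<alpha>)"]
    have "(g has_real_derivative 1 / (1 - \<alpha>) * k x powr (1 / (1 - \<alpha>) - 1) * (2 * (1 - \<alpha>))) (at x)"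
      by (simp add: g_def)
    moreover have "1 / (1 - \<alpha>) - 1 = 1 / (1 - \<alpha>) * \<alpha>" using \<alpha> by (simp add: field_simps)
    then have "k x powr (1 / (1 - \<alpha>) - 1) = g x powr \<alpha>" by (simp add: g_def powr_powr)
    moreover have "1 / (1 - \<alpha>) * y * (2 * (1 - \<alpha>)) = 2 * y" for y
      using \<alpha> by (simp add: field_simps)
    ultimately show ?thesis by simp
  qed
  have k0: "k 0 > 0" using b by (simp add: k_def)
  have "isCont k 0" unfolding k_def by (intro continuous_intros)
  moreover have "isCont g 0" by (rule DERIV_isCont[OF dg[OF k0]])
  ultimately have "\<forall>\<^sub>F x in nhds 0. k x > 0" "\<forall>\<^sub>F x in nhds 0. g x < S"
    using k0 g0 b by (auto simp: continuous_at_imp_continuous_at_within isCont_def tendsto_at_iff_tendsto_nhds intro: order_tendstoD)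
  then have "\<forall>\<^sub>F x in nhds 0. k x > 0 \<and> g x < S" by eventually_elim auto
  then obtain d where d: "d > 0" "\<And>x. \<bar>x\<bar> < d \<Longrightarrow> k x > 0 \<and> g x < S"
    unfolding eventually_nhds_metric by auto
  define r where "r = min d 2"
  have r: "0 < r" "r \<le> 2" using d by (auto simp: r_def)
  have "\<And>x. \<bar>x\<bar> < r \<Longrightarrow> (g has_real_derivative 2 * g x powr \<alpha>) (at x)"
    and "\<And>x. \<bar>x\<bar> < r \<Longrightarrow> 0 \<le> g x \<and> g x < S"
    using d dg by (auto simp: r_def g_def)
  from J_holomorphic_disk_of_ODE[OF r \<alpha>(1) this] show ?thesis
    by (intro that[OF r(1)]) (auto simp: g0)
qed

section \<open>The jump of the pseudonorm\<close>

theorem mainTheorem3: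
  fixes \<alpha> :: real
  assumes "0 < \<alpha>" and "\<alpha> < 1"
  shows "\<not> upper_semicontinuous_on (tangent_bundle (Omega (S_crit \<alpha>)))
           (kobayashi_royden (Omega (S_crit \<alpha>)) (J_mat (lambda_alpha \<alpha>)))"
proof
  let ?S = "S_crit \<alpha>"
  let ?K = "kobayashi_royden (Omega ?S) (J_mat (lambda_alpha \<alpha>))"
  let ?T = "tangent_bundle (Omega ?S)"
  \<comment> \<open>The third component of the vector is dictated by the explicit disk through (0,
    b); it tends to 0 with b, so the limit point is (0, d/dx_1).\<close>
  let ?p = "\<lambda>b. (vector [0, 0, b, 0], vector [1, 0, 2 * b powr \<alpha>, 0]) :: (real^4) \<times> (real^4)"
  assume usc: "upper_semicontinuous_on ?T ?K"
  note S = S_crit_pos[OF assms]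
  have T: "?p b \<in> ?T" if "0 \<le> b" "b < ?S" for b
    using that by (simp add: tangent_bundle_def Omega_def z1_def z2_def disk_def cmod_def)
  have "?K (?p 0) \<le> 1 / 2"
    unfolding kobayashi_royden_def split
  proof (rule cInf_lower)
    have "J_holomorphic_disk (Omega ?S) (J_mat (lambda_alpha \<alpha>)) 2 (\<lambda>z. vector [Re z, Im z, 0, 0])"
      "frechet_derivative (\<lambda>z. vector [Re z, Im z, 0, 0] :: real^4) (at 0) 1 = vector [1, 0, 2 * 0 powr \<alpha>, 0]"
      \<comment> \<open>The zero function solves the same equation on the whole disk of radius
        2.\<close>
      using J_holomorphic_disk_of_ODE[of 2 \<alpha> "\<lambda>_. 0" ?S] assms S by auto
    then show "1 / 2 \<in> {1 / r |r. 0 < r \<and> (\<exists>Z. J_holomorphic_disk (Omega ?S) (J_mat (lambda_alpha \<alpha>)) r Z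
        \<and> Z 0 = vector [0, 0, 0, 0] \<and> frechet_derivative Z (at 0) 1 = vector [1, 0, 2 * 0 powr \<alpha>, 0])}"
      by (intro CollectI exI[of _ 2] conjI exI[of _ "\<lambda>z. vector [Re z, Im z, 0, 0]"]) auto
  qed (auto intro!: bdd_belowI[of _ 0])
  \<comment> \<open>The threshold is 1/1.998, strictly above 1/2 and a lower bound for the
    pseudonorm at every \<open>?p b\<close> with 0 < b < \<open>?S\<close>.\<close>
  then have "?K (?p 0) < 500 / 999" by simp
  with usc T[of 0] S have "\<forall>\<^sub>F y in at (?p 0) within ?T. ?K y < 500 / 999"
    unfolding upper_semicontinuous_on_def by blast
  moreover have "filterlim ?p (at (?p 0) within ?T) (at_right 0)"
    unfolding filterlim_at
  proof
    have "\<forall>\<^sub>F b in at_right 0. b \<in> {0<..<?S}" using S by (intro eventually_at_right_real)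
    then show "\<forall>\<^sub>F b in at_right 0. ?p b \<in> ?T \<and> ?p b \<noteq> ?p 0"
      by eventually_elim (use T in \<open>auto simp: vec_eq_iff forall_4\<close>)
    have vec: "((\<lambda>b. vector [c, 0, g b, 0] :: real^4) \<longlongrightarrow> vector [c, 0, l, 0]) F"
      if "(g \<longlongrightarrow> l) F" for c l :: real and g :: "real \<Rightarrow> real" and F
    proof (rule vec_tendstoI)
      fix i :: 4
      show "((\<lambda>b. vec_nth (vector [c, 0, g b, 0] :: real^4) i) \<longlongrightarrow> vec_nth (vector [c, 0, l, 0]) i) F"
        using exhaust_4[of i] that by auto
    qed
    have "((\<lambda>b. 2 * b powr \<alpha>) \<longlongrightarrow> 2 * 0 powr \<alpha>) (at_right 0)"
      by (intro tendsto_intros tendsto_powr') (use assms in \<open>auto simp: eventually_at_right_less eventually_at_filter\<close>)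
    moreover have "((\<lambda>b. b) \<longlongrightarrow> 0) (at_right (0::real))" by simp
    ultimately show "(?p \<longlongrightarrow> ?p 0) (at_right 0)"
      by (intro tendsto_Pair vec)
  qed
  ultimately have "\<forall>\<^sub>F b in at_right 0. ?K (?p b) < 500 / 999"
    by (rule eventually_compose_filterlim)
  moreover have "\<forall>\<^sub>F b in at_right 0. b \<in> {0<..<?S}" using S by (intro eventually_at_right_real)
  ultimately have "\<forall>\<^sub>F b in at_right 0. ?K (?p b) < 500 / 999 \<and> b \<in> {0<..<?S}" by eventually_elim auto
  then obtain b where b: "?K (?p b) < 500 / 999" "0 < b" "b < ?S"
    using eventually_happens[of _ "at_right (0::real)"] by auto
  \<comment> \<open>A lower bound for all members bounds \<open>Inf\<close> only if the set is
    nonempty, so one disk must be exhibited.\<close>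
  obtain r0 Z0 where "r0 > 0" "J_holomorphic_disk (Omega ?S) (J_mat (lambda_alpha \<alpha>)) r0 Z0"
    "Z0 0 = vector [0, 0, b, 0]" "frechet_derivative Z0 (at 0) 1 = vector [1, 0, 2 * b powr \<alpha>, 0]"
    by (rule J_holomorphic_disk_exists[OF assms b(2,3)])
  then have ne: "1 / r0 \<in> {1 / r |r. 0 < r \<and> (\<exists>Z. J_holomorphic_disk (Omega ?S) (J_mat (lambda_alpha \<alpha>)) r Z
        \<and> Z 0 = vector [0, 0, b, 0] \<and> frechet_derivative Z (at 0) 1 = vector [1, 0, 2 * b powr \<alpha>, 0])}"
    by blast
  have "500 / 999 \<le> ?K (?p b)"
    unfolding kobayashi_royden_def split
  proof (rule cInf_greatest)
    show "{1 / r |r. 0 < r \<and> (\<exists>Z. J_holomorphic_disk (Omega ?S) (J_mat (lambda_alpha \<alpha>)) r Z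
        \<and> Z 0 = vector [0, 0, b, 0] \<and> frechet_derivative Z (at 0) 1 = vector [1, 0, 2 * b powr \<alpha>, 0])} \<noteq> {}"
      using ne by blast
    fix x assume "x \<in> {1 / r |r. 0 < r \<and> (\<exists>Z. J_holomorphic_disk (Omega ?S) (J_mat (lambda_alpha \<alpha>)) r Z
        \<and> Z 0 = vector [0, 0, b, 0] \<and> frechet_derivative Z (at 0) 1 = vector [1, 0, 2 * b powr \<alpha>, 0])}"
    then obtain r Z where rZ: "x = 1 / r" "0 < r" "J_holomorphic_disk (Omega ?S) (J_mat (lambda_alpha \<alpha>)) r Z"
        "Z 0 = vector [0, 0, b, 0]" "frechet_derivative Z (at 0) 1 = vector [1, 0, 2 * b powr \<alpha>, 0]"
      by blast
    have "r \<le> 999 / 500"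
      by (rule J_holomorphic_disk_radius_le[OF assms rZ(3)])
         (use rZ b in \<open>auto simp: z1_def z2_def complex_eq_iff\<close>)
    then show "500 / 999 \<le> x" using frac_le[of 1 1 r "999 / 500"] rZ by simp
  qed
  with b show False by simp
qed

end
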